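(* Let $C\subseteq\mathbb{F}_2^n$ be a binary linear $[n,k,d]$ code with $\mathbf{1}_n\in C$, whose dual $C^\perp$ has minimum distance $d^\perp$, and suppose that $t$ is a positive integer with $$d^\perp-t=\#\{u \mid C_u\neq\emptyset,\ 0<u\le n-t\}$$ and $(d^\perp,t)=(8,5)$. Then $C$ is the extended binary Golay code $\mathcal{G}_{24}$ (the unique binary $[24,12,8]$ code, up to equivalence).
   Context: $\mathbf{1}_n$ is the all-ones vector; $C^\perp$ is the dual code with respect to the standard inner product; $d^\perp$ is the minimum weight of a nonzero codeword of $C^\perp$; $C_u=\{c\in C:\mathrm{wt}(c)=u\}$ where $\mathrm{wt}$ is Hamming weight. *)

theory Defs
  imports Main
begin

text \<open>Binary vectors of length n are identified with their supports, i.e. subsets of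
  the coordinate set {..<n}. Vector addition over F_2 is symmetric difference,
  Hamming weight is card, and the standard inner product is the parity of the
  size of the intersection.\<close>

definition vadd :: "nat set \<Rightarrow> nat set \<Rightarrow> nat set" where
  "vadd a b = (a - b) \<union> (b - a)"

definition binary_linear_code :: "nat \<Rightarrow> nat set set \<Rightarrow> bool" where
  "binary_linear_code n C \<longleftrightarrow>
     (\<forall>c\<in>C. c \<subseteq> {..<n}) \<and> {} \<in> C \<and> (\<forall>a\<in>C. \<forall>b\<in>C. vadd a b \<in> C)"

definition inner :: "nat set \<Rightarrow> nat set \<Rightarrow> bool" where
  "inner a b = odd (card (a \<inter> b))"

definition dual_code :: "nat \<Rightarrow> nat set set \<Rightarrow> nat set set" where
  "dual_code n C = {v. v \<subseteq> {..<n} \<and> (\<forall>c\<in>C. \<not> inner v c)}"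

definition code_dim :: "nat set set \<Rightarrow> nat \<Rightarrow> bool" where
  "code_dim C k \<longleftrightarrow> card C = 2 ^ k"

definition min_dist :: "nat set set \<Rightarrow> nat \<Rightarrow> bool" where
  "min_dist D d \<longleftrightarrow> (\<exists>c\<in>D. c \<noteq> {} \<and> card c = d) \<and> (\<forall>c\<in>D. c \<noteq> {} \<longrightarrow> d \<le> card c)"

definition weight_class :: "nat set set \<Rightarrow> nat \<Rightarrow> nat set set" where
  "weight_class C u = {c \<in> C. card c = u}"

definition xor_sum :: "nat set set \<Rightarrow> nat set" where
  "xor_sum T = {x. odd (card {s \<in> T. x \<in> s})}"

definition span2 :: "nat set set \<Rightarrow> nat set set" where
  "span2 S = {xor_sum T | T. T \<subseteq> S}"

text \<open>Extended binary Golay code G24: the cyclic [23,12,7] Golay code with generator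
  polynomial 1+x^2+x^4+x^5+x^6+x^10+x^11, extended by an overall parity coordinate 23.\<close>
definition golay24 :: "nat set set" where
  "golay24 = span2 ((\<lambda>i. ((\<lambda>j. (i + j) mod 23) ` {0,2,4,5,6,10,11}) \<union> {23}) ` {..<12})"

definition code_equiv :: "nat \<Rightarrow> nat set set \<Rightarrow> nat set set \<Rightarrow> bool" where
  "code_equiv n C D \<longleftrightarrow> (\<exists>\<sigma>. bij_betw \<sigma> {..<n} {..<n} \<and> C = (\<lambda>c. \<sigma> ` c) ` D)"

end

theory Submission
  imports Defs Complex_Main "HOL-Computational_Algebra.Primes"
begin

text \<open>Since the dual distance is 8, \<open>C\<close> is an orthogonal array of strength 7. By the
  Assmus--Mattson argument a weight class below 5 would consist of all sets of that size, which
  contradicts the dual word of weight 8. So the three weights are \<open>a\<close>, \<open>n/2\<close>, \<open>n - a\<close>, and the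
  second, fourth and sixth moments of \<open>n - 2 wt\<close> give \<open>(n - 2 a)\<^sup>2 = 3 n - 8\<close> and
  \<open>n (n\<^sup>2 - 3 n + 8) = 3 \<cdot> 2\<^sup>k\<close>, whence \<open>n = 24\<close>, \<open>k = 12\<close>, \<open>a = 8\<close>.

  For uniqueness, \<open>C\<close> is doubly even, hence self-orthogonal. Choose a dodecad \<open>D\<close>, a point \<open>i\<close> in it
  and a point \<open>z\<close> outside. For each further \<open>j \<in> D\<close> there is exactly one octad that contains \<open>z\<close> and
  meets \<open>D\<close> in \<open>{i, j}\<close>; the remaining five points of these octads form the blocks of a biplane on
  11 points, and self-orthogonality identifies the dual biplane with the one obtained by exchanging
  \<open>D\<close> and its complement. A block of the biplane has five points: the other blocks correspond to
  the edges of the complete graph on them and the other points to six pentagons that pairwise share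
  two edges, so one pentagon determines the others. Hence the biplane is unique, and it determines
  12 words that span \<open>C\<close>.\<close>

subsection \<open>Codes with dual distance 8\<close>

lemma vadd_self_cancel [simp]: "vadd a (vadd a b) = b"
  by (auto simp: vadd_def)

lemma mem_vadd: "x \<in> vadd a b \<longleftrightarrow> (x \<in> a \<longleftrightarrow> x \<notin> b)"
  by (auto simp: vadd_def)

lemma card_vadd:
  assumes "finite a" "finite b"
  shows "card (vadd a b) + 2 * card (a \<inter> b) = card a + card b"
proof -
  have "card (vadd a b) = card (a - b) + card (b - a)"
    unfolding vadd_def using assms by (intro card_Un_disjoint) auto
  moreover have "card a = card (a - b) + card (a \<inter> b)"
    using assms by (subst card_Un_disjoint [symmetric]) (auto intro: arg_cong [where f = card])
  moreover have "card b = card (b - a) + card (a \<inter> b)"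
    using assms by (subst card_Un_disjoint [symmetric]) (auto intro: arg_cong [where f = card])
  ultimately show ?thesis by simp
qed

text \<open>Linearity over F_2 of the inner product with a fixed set \<open>S\<close>: the overlap
  of \<open>a\<close> and \<open>b\<close> is counted twice and drops out modulo 2.\<close>

lemma even_card_vadd_Int:
  assumes "finite a" "finite b"
  shows "even (card (vadd a b \<inter> S)) \<longleftrightarrow> (even (card (a \<inter> S)) \<longleftrightarrow> even (card (b \<inter> S)))"
proof -
  have "vadd a b \<inter> S = vadd (a \<inter> S) (b \<inter> S)"
    by (auto simp: vadd_def)
  then have "card (vadd a b \<inter> S) + 2 * card ((a \<inter> S) \<inter> (b \<inter> S)) = card (a \<inter> S) + card (b \<inter> S)"
    using card_vadd [of "a \<inter> S" "b \<inter> S"] assms by simp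
  then show ?thesis
    by presburger
qed

text \<open>Orthogonality of characters: each new point of \<open>J\<close> contributes a factor 2
  if it lies outside \<open>c\<close> and a factor 0 if it lies inside. This writes the indicator of
  avoiding \<open>J\<close> as a character sum.\<close>

lemma sum_Pow_character:
  assumes "finite J"
  shows "(\<Sum>S\<in>Pow J. (- 1) ^ card (c \<inter> S)) = (if c \<inter> J = {} then 2 ^ card J else (0::int))"
  using assms
proof (induction J rule: finite_induct)
  case empty
  then show ?case by simp
next
  case (insert x J)
  have disj: "Pow J \<inter> insert x ` Pow J = {}"
    using insert.hyps by auto
  have inj: "inj_on (insert x) (Pow J)"
    using insert.hyps by (auto simp: inj_on_def)
  have shift: "(- 1) ^ card (c \<inter> insert x S) = (if x \<in> c then - 1 else 1) * ((- 1) ^ card (c \<inter> S) :: int)"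
    if "S \<in> Pow J" for S
    using that insert.hyps finite_subset [of S J] by (auto simp: card_insert_if)
  have "(\<Sum>S\<in>Pow (insert x J). (- 1) ^ card (c \<inter> S))
      = (\<Sum>S\<in>Pow J. (- 1) ^ card (c \<inter> S)) + (\<Sum>S\<in>Pow J. (- 1) ^ card (c \<inter> insert x S) :: int)"
    using insert.hyps disj by (simp add: Pow_insert sum.union_disjoint sum.reindex [OF inj])
  also have "(\<Sum>S\<in>Pow J. (- 1) ^ card (c \<inter> insert x S))
      = (if x \<in> c then - 1 else 1) * (\<Sum>S\<in>Pow J. (- 1) ^ card (c \<inter> S) :: int)"
    unfolding sum_distrib_left by (intro sum.cong refl shift)
  finally show ?case
    using insert by auto
qed

section \<open>Counting members of a set system with prescribed and forbidden points\<close>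

definition pattern_count :: "'a set set \<Rightarrow> 'a set \<Rightarrow> 'a set \<Rightarrow> nat" where
  "pattern_count F X J = card {c \<in> F. X \<subseteq> c \<and> c \<inter> J = {}}"

lemma pattern_count_split:
  assumes "finite F"
  shows "pattern_count F X J = pattern_count F (insert x X) J + pattern_count F X (insert x J)"
  unfolding pattern_count_def using assms
  by (subst card_Un_disjoint [symmetric]) (auto intro: arg_cong [where f = card])

text \<open>Inclusion-exclusion one point at a time: a prescribed point is either dropped or moved
  to the forbidden set, and neither raises \<open>card X + card J\<close> above \<open>s\<close>.
  Counts of avoidance therefore determine all other counts.\<close>

lemma pattern_count_eq_of_avoid_eq:
  assumes "finite F"
    and avoid: "\<And>J J'. J \<subseteq> G \<Longrightarrow> J' \<subseteq> G \<Longrightarrow> card J = card J' \<Longrightarrow> card J \<le> s \<Longrightarrow>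
        pattern_count F {} J = pattern_count F {} J'"
    and "finite G" "X \<subseteq> G" "X' \<subseteq> G" "J \<subseteq> G" "J' \<subseteq> G" "X \<inter> J = {}" "X' \<inter> J' = {}"
    and "card X = card X'" "card J = card J'" "card X + card J \<le> s"
  shows "pattern_count F X J = pattern_count F X' J'"
  using assms(4-)
proof (induction "card X" arbitrary: X X' J J')
  case 0
  then have "X = {}" "X' = {}"
    using finite_subset [OF _ \<open>finite G\<close>] by (metis card_0_eq)+
  moreover have "pattern_count F {} J = pattern_count F {} J'"
    by (rule avoid) (use 0 in auto)
  ultimately show ?case
    by simp
next
  case (Suc m)
  obtain x Y where X: "X = insert x Y" "x \<notin> Y" "card Y = m"
    using Suc.hyps(2) by (metis card_Suc_eq)
  obtain x' Y' where X': "X' = insert x' Y'" "x' \<notin> Y'" "card Y' = m"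
    using Suc.hyps(2) Suc.prems by (metis card_Suc_eq)
  have fin: "finite J" "finite J'" "finite Y" "finite Y'"
    using Suc.prems \<open>finite G\<close> X X' by (auto intro: finite_subset [of _ G])
  have nin: "x \<notin> J" "x' \<notin> J'"
    using Suc.prems X X' by auto
  have "pattern_count F Y J = pattern_count F Y' J'"
    using Suc.prems X X' fin by (intro Suc.hyps(1)) auto
  moreover have "pattern_count F Y (insert x J) = pattern_count F Y' (insert x' J')"
    using Suc.prems X X' fin nin by (intro Suc.hyps(1)) auto
  ultimately show ?case
    using pattern_count_split [OF \<open>finite F\<close>, of Y J x] pattern_count_split [OF \<open>finite F\<close>, of Y' J' x'] X X'
    by simp
qed

text \<open>Double counting of the pairs \<open>X \<subseteq> c\<close> with
  \<open>card X = j\<close>.\<close>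

lemma sum_card_choose:
  assumes "finite F" "finite G" "\<And>c. c \<in> F \<Longrightarrow> c \<subseteq> G"
  shows "(\<Sum>c\<in>F. card c choose j) = (\<Sum>X | X \<subseteq> G \<and> card X = j. card {c \<in> F. X \<subseteq> c})"
proof -
  have "(\<Sum>c\<in>F. card c choose j) = (\<Sum>c\<in>F. card {X. X \<subseteq> G \<and> card X = j \<and> X \<subseteq> c})"
  proof (intro sum.cong refl)
    fix c assume c: "c \<in> F"
    then have "{X. X \<subseteq> G \<and> card X = j \<and> X \<subseteq> c} = {X. X \<subseteq> c \<and> card X = j}"
      using assms(3) by blast
    then show "card c choose j = card {X. X \<subseteq> G \<and> card X = j \<and> X \<subseteq> c}"
      using n_subsets [of c j] assms(2,3) c finite_subset by metis
  qed
  also have "\<dots> = (\<Sum>c\<in>F. card {X \<in> {X. X \<subseteq> G \<and> card X = j}. X \<subseteq> c})"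
    by (simp add: conj_ac)
  also have "\<dots> = (\<Sum>X | X \<subseteq> G \<and> card X = j. card {c \<in> F. X \<subseteq> c})"
    using assms by (intro sum_multicount_gen) auto
  finally show ?thesis .
qed

section \<open>Orthogonal arrays of strength 7 from dual distance at least 8\<close>

locale dual_distance_8_code =
  fixes n :: nat and C :: "nat set set"
  assumes linear: "binary_linear_code n C"
    and dual_weight: "\<And>v. v \<in> dual_code n C \<Longrightarrow> v \<noteq> {} \<Longrightarrow> 8 \<le> card v"
begin

lemma subset: "c \<in> C \<Longrightarrow> c \<subseteq> {..<n}"
  and empty_mem: "{} \<in> C"
  and vadd_mem: "a \<in> C \<Longrightarrow> b \<in> C \<Longrightarrow> vadd a b \<in> C"
  using linear by (auto simp: binary_linear_code_def)

lemma finite_word: "c \<in> C \<Longrightarrow> finite c"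
  using subset finite_subset by blast

lemma finite_code: "finite C"
  using subset finite_subset [of C "Pow {..<n}"] by blast

text \<open>Such an \<open>S\<close> is too small to be a dual word, so some word \<open>c0\<close>
  meets it oddly; translation by \<open>c0\<close> permutes \<open>C\<close> and flips every
  sign.\<close>

lemma character_sum:
  assumes "S \<subseteq> {..<n}" "S \<noteq> {}" "card S \<le> 7"
  shows "(\<Sum>c\<in>C. (- 1) ^ card (c \<inter> S)) = (0::int)"
proof -
  have "S \<notin> dual_code n C"
    using dual_weight [of S] assms by auto
  then obtain c0 where c0: "c0 \<in> C" "odd (card (c0 \<inter> S))"
    using assms(1) by (auto simp: dual_code_def inner_def Int_commute)
  have "(\<Sum>c\<in>C. (- 1) ^ card (c \<inter> S)) = (\<Sum>c\<in>C. (- 1) ^ card (vadd c0 c \<inter> S) :: int)"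
    by (rule sum.reindex_bij_witness [where i = "vadd c0" and j = "vadd c0"])
      (use c0 vadd_mem in auto)
  also have "\<dots> = (\<Sum>c\<in>C. - ((- 1) ^ card (c \<inter> S)))"
  proof (intro sum.cong refl)
    fix c assume "c \<in> C"
    then show "(- 1) ^ card (vadd c0 c \<inter> S) = - ((- 1) ^ card (c \<inter> S) :: int)"
      using even_card_vadd_Int [of c0 c S] c0 finite_word by (simp add: minus_one_power_iff)
  qed
  finally show ?thesis
    by (simp add: sum_negf)
qed

text \<open>Expand the indicator of avoiding \<open>J\<close> into characters and exchange the sums:
  every nonempty \<open>S \<subseteq> J\<close> contributes 0, and \<open>S = {}\<close> contributes
  \<open>card C\<close>.\<close>

lemma avoid_count:
  assumes "J \<subseteq> {..<n}" "card J \<le> 7"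
  shows "2 ^ card J * pattern_count C {} J = card C"
proof -
  have fin: "finite J"
    using assms(1) finite_subset by blast
  have "int (2 ^ card J * pattern_count C {} J) = (\<Sum>c\<in>C. if c \<inter> J = {} then 2 ^ card J else 0)"
    using finite_code by (simp add: pattern_count_def sum.If_cases Int_def)
  also have "\<dots> = (\<Sum>c\<in>C. \<Sum>S\<in>Pow J. (- 1) ^ card (c \<inter> S))"
    by (simp only: sum_Pow_character [OF fin])
  also have "\<dots> = (\<Sum>S\<in>Pow J. \<Sum>c\<in>C. (- 1) ^ card (c \<inter> S))"
    by (rule sum.swap)
  also have "\<dots> = (\<Sum>S\<in>{{}}. \<Sum>c\<in>C. (- 1) ^ card (c \<inter> S))"
  proof (rule sum.mono_neutral_right)
    show "\<forall>S\<in>Pow J - {{}}. (\<Sum>c\<in>C. (- 1) ^ card (c \<inter> S)) = (0::int)"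
    proof
      fix S assume S: "S \<in> Pow J - {{}}"
      then have "card S \<le> card J"
        using fin by (simp add: card_mono)
      with S assms show "(\<Sum>c\<in>C. (- 1) ^ card (c \<inter> S)) = (0::int)"
        by (intro character_sum) auto
    qed
  qed (use fin in auto)
  finally have "int (2 ^ card J * pattern_count C {} J) = int (card C)"
    by simp
  then show ?thesis
    by (simp only: of_nat_eq_iff)
qed

text \<open>This is the orthogonal array property in full. The all-zero patterns are already known,
  and splitting off one prescribed point at a time gives the others.\<close>

lemma pattern_count_code:
  assumes "X \<subseteq> {..<n}" "J \<subseteq> {..<n}" "X \<inter> J = {}" "card X + card J \<le> 7"
  shows "2 ^ (card X + card J) * pattern_count C X J = card C"
  using assms
proof (induction "card X" arbitrary: X J)
  case 0
  then have "X = {}"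
    using finite_subset [OF \<open>X \<subseteq> {..<n}\<close>] by auto
  then show ?case
    using avoid_count 0 by simp
next
  case (Suc m)
  obtain x Y where X: "X = insert x Y" "x \<notin> Y" "card Y = m"
    using Suc.hyps(2) by (metis card_Suc_eq)
  have fin: "finite J" "finite Y"
    using Suc.prems X by (auto intro: finite_subset [of _ "{..<n}"])
  have nin: "x \<notin> J"
    using Suc.prems X by auto
  have "2 ^ (card Y + card J) * pattern_count C Y J = card C"
    using Suc.prems X fin by (intro Suc.hyps(1)) auto
  moreover have "2 ^ (card Y + card (insert x J)) * pattern_count C Y (insert x J) = card C"
    using Suc.prems X fin nin by (intro Suc.hyps(1)) auto
  ultimately show ?case
    using pattern_count_split [OF finite_code, of Y J x] X fin nin
    by (simp add: algebra_simps)
qed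

text \<open>Double counting in the words that avoid \<open>J\<close>, each \<open>j\<close>-set
  being covered equally often by strength 7. The case \<open>J = {}\<close> gives the moments of the
  weight distribution.\<close>

lemma binomial_moment:
  assumes "J \<subseteq> {..<n}" "card J + j \<le> 7"
  shows "2 ^ (card J + j) * (\<Sum>c | c \<in> C \<and> c \<inter> J = {}. card c choose j) = ((n - card J) choose j) * card C"
proof -
  let ?G = "{..<n} - J"
  have "(\<Sum>c | c \<in> C \<and> c \<inter> J = {}. card c choose j)
      = (\<Sum>X | X \<subseteq> ?G \<and> card X = j. card {c \<in> {c. c \<in> C \<and> c \<inter> J = {}}. X \<subseteq> c})"
    using finite_code subset by (intro sum_card_choose) auto
  also have "2 ^ (card J + j) * \<dots> = (\<Sum>X | X \<subseteq> ?G \<and> card X = j. card C)"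
    unfolding sum_distrib_left
  proof (intro sum.cong refl)
    fix X assume X: "X \<in> {X. X \<subseteq> ?G \<and> card X = j}"
    have "{c \<in> {c. c \<in> C \<and> c \<inter> J = {}}. X \<subseteq> c} = {c \<in> C. X \<subseteq> c \<and> c \<inter> J = {}}"
      by auto
    then show "2 ^ (card J + j) * card {c \<in> {c. c \<in> C \<and> c \<inter> J = {}}. X \<subseteq> c} = card C"
      using pattern_count_code [of X J] X assms by (auto simp: pattern_count_def add.commute)
  qed
  also have "\<dots> = ((n - card J) choose j) * card C"
    using assms finite_subset [OF assms(1)] by (simp add: n_subsets card_Diff_subset)
  finally show ?thesis .
qed

section \<open>The Assmus-Mattson argument and the exclusion of small weights\<close>

abbreviation weights :: "nat set" where
  "weights \<equiv> {u. weight_class C u \<noteq> {} \<and> 0 < u \<and> u \<le> n - 5}"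

text \<open>The quadratic \<open>p\<close> vanishes at the other two weights, so its sum over the
  words avoiding a 5-set isolates weight \<open>w\<close>, apart from the zero word. That sum needs
  only moments up to order 2, which are available because 5 + 2 = 7.\<close>

lemma avoid_count_weight_class:
  assumes wts: "weights = {w, w2, w3}" and w: "w \<noteq> w2" "w \<noteq> w3"
    and T: "T \<subseteq> {..<n}" "card T = 5" and T': "T' \<subseteq> {..<n}" "card T' = 5"
  shows "pattern_count (weight_class C w) {} T = pattern_count (weight_class C w) {} T'"
proof -
  define p where "p m = (int m - int w2) * (int m - int w3)" for m
  have p_choose: "p m = 2 * int (m choose 2) + (1 - int w2 - int w3) * int (m choose 1) + int w2 * int w3 * int (m choose 0)" for m
  proof -
    have "even (m * (m - 1))"
      by (cases m) auto
    then have "2 * (m choose 2) = m * (m - 1)"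
      by (simp add: choose_two)
    then have "2 * int (m choose 2) = int m * (int m - 1)"
      by (cases m) (simp_all flip: of_nat_mult add: algebra_simps)
    then show ?thesis
      by (simp add: p_def algebra_simps)
  qed
  \<comment> \<open>The factor 128 is \<open>2 ^ (5 + 2)\<close> and clears the denominators of all
    three moments.\<close>
  have sum_p: "128 * (\<Sum>c | c \<in> C \<and> c \<inter> S = {}. p (card c))
      = (2 * int ((n - 5) choose 2) + 2 * (1 - int w2 - int w3) * int (n - 5) + 4 * int w2 * int w3) * int (card C)"
    if S: "S \<subseteq> {..<n}" "card S = 5" for S
  proof -
    have m: "2 ^ (5 + j) * (\<Sum>c | c \<in> C \<and> c \<inter> S = {}. int (card c choose j)) = int ((n - 5) choose j) * int (card C)"
      if "j \<le> 2" for j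
      using arg_cong [where f = int, OF binomial_moment [OF S(1), of j]] S that by simp
    have "(\<Sum>c | c \<in> C \<and> c \<inter> S = {}. p (card c))
      = 2 * (\<Sum>c | c \<in> C \<and> c \<inter> S = {}. int (card c choose 2))
        + (1 - int w2 - int w3) * (\<Sum>c | c \<in> C \<and> c \<inter> S = {}. int (card c choose 1))
        + int w2 * int w3 * (\<Sum>c | c \<in> C \<and> c \<inter> S = {}. int (card c choose 0))"
      unfolding p_choose sum.distrib sum_distrib_left ..
    moreover have "128 * (\<Sum>c | c \<in> C \<and> c \<inter> S = {}. int (card c choose 2)) = int ((n - 5) choose 2) * int (card C)"
      using m [of 2] by simp
    moreover have "64 * (\<Sum>c | c \<in> C \<and> c \<inter> S = {}. int (card c choose 1)) = int (n - 5) * int (card C)"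
      using m [of 1] by simp
    moreover have "32 * (\<Sum>c | c \<in> C \<and> c \<inter> S = {}. int (card c choose 0)) = int (card C)"
      using m [of 0] by simp
    ultimately show ?thesis
      by algebra
  qed
  have sum_class: "(\<Sum>c | c \<in> C \<and> c \<inter> S = {}. p (card c)) = p 0 + p w * int (pattern_count (weight_class C w) {} S)"
    if S: "S \<subseteq> {..<n}" "card S = 5" for S
  proof -
    let ?F = "{c. c \<in> C \<and> c \<inter> S = {}}"
    have w0: "0 < w"
      using wts by blast
    \<comment> \<open>A word avoiding \<open>S\<close> lives on \<open>n - 5\<close> coordinates, so
      its weight is 0 or one of the three listed; this is where the bound \<open>n - 5\<close> in
      \<open>weights\<close> comes from.\<close>
    have "p (card c) = (if c = {} then p 0 else 0) + (if card c = w then p w else 0)" if c: "c \<in> ?F" for c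
    proof (cases "c = {}")
      case False
      have "c \<subseteq> {..<n} - S"
        using c subset by blast
      then have "card c \<le> n - 5"
        using S card_mono [of "{..<n} - S" c] finite_subset [OF S(1)] by (simp add: card_Diff_subset)
      moreover have "0 < card c"
        using False finite_word c by (simp add: card_gt_0_iff)
      ultimately have "card c \<in> weights"
        using c by (auto simp: weight_class_def)
      then have "card c \<in> {w, w2, w3}"
        using wts by simp
      then show ?thesis
        using False by (auto simp: p_def)
    qed (use w0 in auto)
    then have "(\<Sum>c\<in>?F. p (card c)) = (\<Sum>c\<in>?F. if c = {} then p 0 else 0) + (\<Sum>c\<in>?F. if card c = w then p w else 0)"
      by (simp add: sum.distrib)
    also have "(\<Sum>c\<in>?F. if c = {} then p 0 else 0) = p 0"
      using finite_code empty_mem by (simp add: sum.delta)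
    also have "(\<Sum>c\<in>?F. if card c = w then p w else 0) = p w * int (card {c \<in> ?F. card c = w})"
      using finite_code by (simp add: sum.If_cases Int_def mult.commute)
    also have "{c \<in> ?F. card c = w} = {c \<in> weight_class C w. {} \<subseteq> c \<and> c \<inter> S = {}}"
      by (auto simp: weight_class_def)
    finally show ?thesis
      unfolding pattern_count_def .
  qed
  have "p w \<noteq> 0"
    using w by (simp add: p_def)
  moreover have "128 * (p 0 + p w * int (pattern_count (weight_class C w) {} T))
      = 128 * (p 0 + p w * int (pattern_count (weight_class C w) {} T'))"
    unfolding sum_class [OF T, symmetric] sum_class [OF T', symmetric] sum_p [OF T] sum_p [OF T'] ..
  ultimately show ?thesis
    by simp
qed

text \<open>Double counting of the pairs of a word avoiding \<open>J\<close> and a point outside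
  both: this passes from avoided sets of one size to the next smaller size. The bound on
  \<open>w + card J\<close> makes the divisor positive.\<close>

lemma avoid_count_extend:
  assumes "J \<subseteq> {..<n}" "w + card J < n"
    and K: "\<And>x. x \<in> {..<n} - J \<Longrightarrow> pattern_count (weight_class C w) {} (insert x J) = K"
  shows "pattern_count (weight_class C w) {} J = (n - card J) * K div (n - card J - w)"
proof -
  let ?F = "{c \<in> weight_class C w. c \<inter> J = {}}"
  have finJ: "finite J" and finF: "finite ?F"
    using assms(1) finite_subset finite_code by (auto simp: weight_class_def)
  have "(n - card J) * K = (\<Sum>x\<in>{..<n} - J. pattern_count (weight_class C w) {} (insert x J))"
    using assms(1) finJ K by (simp add: card_Diff_subset)
  also have "\<dots> = (\<Sum>x\<in>{..<n} - J. card {c \<in> ?F. x \<notin> c})"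
    unfolding pattern_count_def by (intro sum.cong refl arg_cong [where f = card]) auto
  also have "\<dots> = (\<Sum>c\<in>?F. card {x \<in> {..<n} - J. x \<notin> c})"
    using finF by (intro sum_multicount_gen [symmetric]) auto
  also have "\<dots> = (\<Sum>c\<in>?F. n - card J - w)"
  proof (intro sum.cong refl)
    fix c assume c: "c \<in> ?F"
    then have c': "c \<subseteq> {..<n} - J" "finite c" "card c = w"
      using subset finite_word by (auto simp: weight_class_def)
    have "{x \<in> {..<n} - J. x \<notin> c} = ({..<n} - J) - c"
      by auto
    then show "card {x \<in> {..<n} - J. x \<notin> c} = n - card J - w"
      using c' finJ assms(1) by (simp add: card_Diff_subset)
  qed
  also have "\<dots> = pattern_count (weight_class C w) {} J * (n - card J - w)"
    by (simp add: pattern_count_def)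
  finally show ?thesis
    using assms(2) by simp
qed

text \<open>Assmus--Mattson: the words of weight \<open>w\<close> avoid all 5-sets equally often, so they form a
  5-design, and a 5-design with blocks of size at most 5 is complete.\<close>

lemma low_weight_class_complete:
  assumes wts: "weights = {w, w2, w3}" and w: "w \<noteq> w2" "w \<noteq> w3" "w \<le> 4" and n: "9 \<le> n"
    and X: "X \<subseteq> {..<n}" "card X = w"
  shows "X \<in> C"
proof -
  let ?H = "weight_class C w"
  have finH: "finite ?H"
    using finite_code by (simp add: weight_class_def)
  \<comment> \<open>Downward induction on the size of the avoided set, with
    \<open>i = 5 - card J\<close>; the 5-sets are the base case.\<close>
  have const: "\<exists>K. \<forall>J. J \<subseteq> {..<n} \<longrightarrow> card J + i = 5 \<longrightarrow> pattern_count ?H {} J = K" if "i \<le> 5" for i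
    using that
  proof (induction i)
    case 0
    have "{..<5} \<subseteq> {..<n}" "card {..<5::nat} = 5"
      using n by auto
    then show ?case
      using avoid_count_weight_class [OF wts w(1,2)] by (metis add.right_neutral)
  next
    case (Suc i)
    then obtain K where K: "\<And>J. J \<subseteq> {..<n} \<Longrightarrow> card J + i = 5 \<Longrightarrow> pattern_count ?H {} J = K"
      by auto
    have "pattern_count ?H {} J = (n - card J) * K div (n - card J - w)"
      if J: "J \<subseteq> {..<n}" "card J + Suc i = 5" for J
    proof (rule avoid_count_extend)
      show "pattern_count ?H {} (insert x J) = K" if "x \<in> {..<n} - J" for x
        using that J finite_subset [OF J(1)] by (intro K) auto
    qed (use J w n in auto)
    moreover have "card J = 4 - i" if "card J + Suc i = 5" for J :: "nat set"
      using that by simp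
    ultimately show ?case
      by metis
  qed
  have avoid: "pattern_count ?H {} J = pattern_count ?H {} J'"
    if "J \<subseteq> {..<n}" "J' \<subseteq> {..<n}" "card J = card J'" "card J \<le> 5" for J J'
    using const [of "5 - card J"] that by (metis diff_le_self le_add_diff_inverse)
  have "w \<in> weights"
    using wts by simp
  then obtain c where c: "c \<in> C" "card c = w"
    by (auto simp: weight_class_def)
  \<comment> \<open>All \<open>w\<close>-sets are contained in equally many words of weight
    \<open>w\<close>, and for the support of an actual word this number is positive.\<close>
  have "pattern_count ?H X {} = pattern_count ?H c {}"
  proof (rule pattern_count_eq_of_avoid_eq [OF finH avoid])
    show "c \<subseteq> {..<n}"
      using c subset by simp
  qed (use X c w in simp_all)
  moreover have "c \<in> {c' \<in> ?H. c \<subseteq> c' \<and> c' \<inter> {} = {}}"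
    using c by (simp add: weight_class_def)
  then have "0 < pattern_count ?H c {}"
    unfolding pattern_count_def using finH by (auto simp only: card_gt_0_iff finite_Collect_conjI Collect_mem_eq)
  ultimately have "{c' \<in> ?H. X \<subseteq> c' \<and> c' \<inter> {} = {}} \<noteq> {}"
    unfolding pattern_count_def by (metis card.empty less_irrefl)
  then obtain c' where "c' \<in> C" "card c' = w" "X \<subseteq> c'"
    by (auto simp: weight_class_def)
  then show ?thesis
    using X card_subset_eq finite_word by metis
qed

text \<open>If all \<open>u\<close>-sets were words, exchanging a point of \<open>v\<close> for a
  point outside \<open>v\<close> would change the parity of the intersection with
  \<open>v\<close>.\<close>

lemma three_weights_ge_5:
  assumes v: "v \<in> dual_code n C" "card v = 8" and three: "card weights = 3"
  shows "9 \<le> n" and "\<And>u. u \<in> weights \<Longrightarrow> 5 \<le> u"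
proof -
  have v_sub: "v \<subseteq> {..<n}" and v_orth: "\<And>c. c \<in> C \<Longrightarrow> even (card (v \<inter> c))"
    using v(1) by (auto simp: dual_code_def inner_def)
  have "8 \<le> n"
    using card_mono [OF _ v_sub] v(2) by simp
  moreover have "n \<noteq> 8"
  proof
    assume n8: "n = 8"
    \<comment> \<open>Here \<open>n - 5 = 3\<close>, so three weights force a word of weight 1,
      which is not orthogonal to the full set \<open>v\<close>.\<close>
    then have "weights \<subseteq> {1, 2, 3}"
      by auto
    then have "weights = {1, 2, 3}"
      using three by (intro card_subset_eq) auto
    then have "1 \<in> weights"
      by simp
    then obtain c where c: "c \<in> C" "card c = 1"
      by (auto simp: weight_class_def)
    have "v = {..<n}"
      using v_sub v(2) n8 by (intro card_subset_eq) auto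
    then have "v \<inter> c = c"
      using subset c by blast
    then show False
      using v_orth [OF c(1)] c by simp
  qed
  ultimately show n9: "9 \<le> n"
    by simp
  show "5 \<le> u" if u: "u \<in> weights" for u
  proof (rule ccontr)
    assume "\<not> 5 \<le> u"
    obtain a b c where abc: "weights = {a, b, c}" "a \<noteq> b" "a \<noteq> c" "b \<noteq> c"
      using three by (auto simp: card_3_iff)
    then consider "u = a" | "u = b" | "u = c"
      using u by auto
    then obtain w2 w3 where wts: "weights = {u, w2, w3}" "u \<noteq> w2" "u \<noteq> w3"
      using abc by cases (metis insert_commute)+
    have complete: "X \<in> C" if "X \<subseteq> {..<n}" "card X = u" for X
      using low_weight_class_complete [OF wts] that n9 \<open>\<not> 5 \<le> u\<close> by simp
    have u0: "0 < u"
      using u by blast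
    obtain i where i: "i \<in> v"
      using v(2) by fastforce
    have "\<not> {..<n} \<subseteq> v"
      using card_mono [of v "{..<n}"] finite_subset [OF v_sub] v(2) n9 by auto
    then obtain j where j: "j < n" "j \<notin> v"
      by auto
    \<comment> \<open>Since \<open>n \<ge> 9\<close>, at least seven points remain besides
      \<open>i\<close> and \<open>j\<close>, enough for a common remainder \<open>Y\<close> of both
      words.\<close>
    have "u - 1 \<le> card ({..<n} - {i, j})"
      using card_Diff_subset [of "{i, j}" "{..<n}"] i j v_sub n9 \<open>\<not> 5 \<le> u\<close>
      by (cases "i = j") auto
    then obtain Y where Y: "Y \<subseteq> {..<n} - {i, j}" "card Y = u - 1" "finite Y"
      by (rule obtain_subset_with_card_n)
    have "insert i Y \<in> C" "insert j Y \<in> C"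
      using Y i j v_sub u0 by (auto intro!: complete simp: card_insert_if)
    then have "even (card (v \<inter> insert i Y))" "even (card (v \<inter> insert j Y))"
      using v_orth by auto
    moreover have "v \<inter> insert i Y = insert i (v \<inter> Y)" "v \<inter> insert j Y = v \<inter> Y"
      using i j by auto
    ultimately show False
      using Y by (auto simp: card_insert_if)
  qed
qed

end

section \<open>The Diophantine equation for the length\<close>

lemma dvd_3_times_2_power:
  fixes q :: nat
  assumes "q dvd 3 * 2 ^ k"
  obtains i where "q = 2 ^ i \<or> q = 3 * 2 ^ i"
proof -
  obtain a b where ab: "q = a * b" "a dvd 3" "b dvd 2 ^ k"
    using division_decomp [OF assms] by blast
  obtain i where "b = 2 ^ i"
    using ab(3) divides_primepow_nat [of 2 b k] by auto
  moreover have "a = 1 \<or> a = 3"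
    using ab(2) prime_nat_iff [of 3] by auto
  ultimately show ?thesis
    using that [of i] ab(1) by auto
qed

text \<open>The equation says \<open>n * q = 3 * 2 ^ k\<close>, so both factors are powers of 2 up
  to a factor 3. As \<open>q\<close> is large it is divisible by 16, and then 16 cannot divide
  \<open>n\<close>, because \<open>q\<close> is 8 modulo \<open>n\<close>.\<close>

lemma golay_length_equation:
  fixes n k :: nat
  assumes n: "9 \<le> n" and eq: "n ^ 3 + 8 * n = 3 * 2 ^ k + 3 * n ^ 2"
  shows "n = 24"
proof -
  define q where "q = n * (n - 3) + 8"
  define r where "r = n - 3"
  then have r: "n = r + 3"
    using n by simp
  have q: "q = n * r + 8"
    by (simp add: q_def r)
  have "n * q = 3 * 2 ^ k"
    using eq by (simp add: q r power2_eq_square power3_eq_cube algebra_simps)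
  then have "n dvd 3 * 2 ^ k" "q dvd 3 * 2 ^ k"
    by (metis dvd_triv_left, metis dvd_triv_right)
  then obtain i j where i: "n = 2 ^ i \<or> n = 3 * 2 ^ i" and j: "q = 2 ^ j \<or> q = 3 * 2 ^ j"
    by (meson dvd_3_times_2_power)
  \<comment> \<open>The bound is 9 * 6 + 8; it exceeds 3 * 8, so the exponent in \<open>q\<close> is
    at least 4.\<close>
  have "62 \<le> q"
    using mult_le_mono [of 9 n 6 r] n r q by simp
  have j4: "4 \<le> j"
  proof (rule ccontr)
    assume "\<not> 4 \<le> j"
    then have "j = 0 \<or> j = 1 \<or> j = 2 \<or> j = 3"
      by auto
    then show False
      using j \<open>62 \<le> q\<close> by auto
  qed
  then have "(16::nat) dvd q"
    using j le_imp_power_dvd [OF j4, of "2::nat"] by auto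
  have "i \<le> 3"
  proof (rule ccontr)
    assume "\<not> i \<le> 3"
    then have "(16::nat) dvd n"
      using i le_imp_power_dvd [of 4 i "2::nat"] by auto
    then have "(16::nat) dvd 8"
      using \<open>16 dvd q\<close> q by (metis dvd_add_right_iff dvd_mult2)
    then show False
      by simp
  qed
  then have "i = 0 \<or> i = 1 \<or> i = 2 \<or> i = 3"
    by auto
  then have "n = 12 \<or> n = 24"
    using i n by auto
  moreover have "n \<noteq> 12"
  proof
    assume "n = 12"
    then have "q = 116"
      by (simp add: q_def)
    then show False
      using \<open>16 dvd q\<close> by simp
  qed
  ultimately show ?thesis
    by simp
qed

section \<open>Power moments and the parameters of the code\<close>

context dual_distance_8_code
begin

lemma falling_factorial_moment:
  assumes "j \<le> 7"
  shows "2 ^ j * (\<Sum>c\<in>C. \<Prod>i<j. real (card c) - real i) = (\<Prod>i<j. real n - real i) * real (card C)"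
proof -
  have fall: "real (m choose j) * fact j = (\<Prod>i<j. real m - real i)" for m
    by (simp add: binomial_gbinomial gbinomial_mult_fact' atLeast0LessThan)
  have "2 ^ j * (\<Sum>c\<in>C. real (card c choose j)) = real (n choose j) * real (card C)"
    using arg_cong [where f = real, OF binomial_moment [of "{}" j]] assms by simp
  then have "2 ^ j * (\<Sum>c\<in>C. real (card c choose j)) * fact j = real (n choose j) * fact j * real (card C)"
    by simp
  then show ?thesis
    by (simp add: fall sum_distrib_right [symmetric] flip: mult.assoc)
       (simp add: sum_distrib_right fall mult.assoc)
qed

text \<open>The first even moments of the sum of \<open>n\<close> independent signs.\<close>

lemma even_power_moments:
  shows "(\<Sum>c\<in>C. (real n - 2 * real (card c)) ^ 2) = real n * card C" (is ?two)
    and "(\<Sum>c\<in>C. (real n - 2 * real (card c)) ^ 4) = (3 * real n ^ 2 - 2 * real n) * card C" (is ?four)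
    and "(\<Sum>c\<in>C. (real n - 2 * real (card c)) ^ 6)
      = (15 * real n ^ 3 - 30 * real n ^ 2 + 16 * real n) * card C" (is ?six)
proof -
  define N where "N = real (card C)"
  define x where "x = real n"
  define M where "M i = (\<Sum>c\<in>C. real (card c) ^ i)" for i
  define f where "f j m = (\<Prod>i<j. m - real i)" for j m
  define S where "S j = (\<Sum>c\<in>C. f j (real (card c)))" for j
  have f1: "f 1 m = m"
    and f2: "f 2 m = m * (m - 1)"
    and f3: "f 3 m = m * (m - 1) * (m - 2)"
    and f4: "f 4 m = m * (m - 1) * (m - 2) * (m - 3)"
    and f5: "f 5 m = m * (m - 1) * (m - 2) * (m - 3) * (m - 4)"
    and f6: "f 6 m = m * (m - 1) * (m - 2) * (m - 3) * (m - 4) * (m - 5)" for m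
    by (simp_all add: f_def numeral_eq_Suc)
  note fs = f1 f2 f3 f4 f5 f6
  have M1: "M 1 = S 1"
    unfolding M_def S_def f1 by simp
  \<comment> \<open>The coefficients are Stirling numbers of the second kind, converting powers to
    falling factorials.\<close>
  have "M 2 = S 2 + S 1"
    and "M 3 = S 3 + 3 * S 2 + S 1"
    and "M 4 = S 4 + 6 * S 3 + 7 * S 2 + S 1"
    and "M 5 = S 5 + 10 * S 4 + 25 * S 3 + 15 * S 2 + S 1"
    and "M 6 = S 6 + 15 * S 5 + 65 * S 4 + 90 * S 3 + 31 * S 2 + S 1"
    unfolding M_def S_def sum_distrib_left sum.distrib [symmetric]
    by (unfold fs) (intro sum.cong refl, algebra)+
  note Ms = M1 this
  have S: "2 ^ j * S j = f j x * N" if "j \<le> 7" for j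
    using falling_factorial_moment [OF that] by (simp add: S_def f_def x_def N_def)
  have Ss: "2 * S 1 = x * N" "4 * S 2 = x * (x - 1) * N" "8 * S 3 = x * (x - 1) * (x - 2) * N"
    "16 * S 4 = x * (x - 1) * (x - 2) * (x - 3) * N"
    "32 * S 5 = x * (x - 1) * (x - 2) * (x - 3) * (x - 4) * N"
    "64 * S 6 = x * (x - 1) * (x - 2) * (x - 3) * (x - 4) * (x - 5) * N"
    using S [of 1] S [of 2] S [of 3] S [of 4] S [of 5] S [of 6] by (simp_all add: fs [simplified])
  have N: "N = (\<Sum>c\<in>C. 1)"
    by (simp add: N_def)
  have "(\<Sum>c\<in>C. (x - 2 * real (card c)) ^ 2) = x ^ 2 * N + (- 4 * x) * M 1 + 4 * M 2"
    unfolding M_def N sum_distrib_left sum.distrib [symmetric]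
    by (intro sum.cong refl) algebra
  then show ?two
    using Ms Ss unfolding x_def [symmetric] N_def [symmetric] by algebra
  have "(\<Sum>c\<in>C. (x - 2 * real (card c)) ^ 4)
      = x ^ 4 * N + (- 8 * x ^ 3) * M 1 + (24 * x ^ 2) * M 2 + (- 32 * x) * M 3 + 16 * M 4"
    unfolding M_def N sum_distrib_left sum.distrib [symmetric]
    by (intro sum.cong refl) algebra
  then show ?four
    using Ms Ss unfolding x_def [symmetric] N_def [symmetric] by algebra
  have "(\<Sum>c\<in>C. (x - 2 * real (card c)) ^ 6)
      = x ^ 6 * N + (- 12 * x ^ 5) * M 1 + (60 * x ^ 4) * M 2 + (- 160 * x ^ 3) * M 3
        + (240 * x ^ 2) * M 4 + (- 192 * x) * M 5 + 64 * M 6"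
    unfolding M_def N sum_distrib_left sum.distrib [symmetric]
    by (intro sum.cong refl) algebra
  then show ?six
    using Ms Ss unfolding x_def [symmetric] N_def [symmetric] by algebra
qed

text \<open>The all-ones word makes \<open>weights\<close> symmetric under complement, which leaves
  one unknown weight \<open>a\<close>. The even moments then yield two equations in
  \<open>a\<close>, \<open>n\<close> and \<open>card C\<close> that no longer involve weight
  frequencies.\<close>

lemma golay_parameters:
  assumes ones: "{..<n} \<in> C" and size: "card C = 2 ^ k"
    and v: "v \<in> dual_code n C" "card v = 8" and three: "card weights = 3"
  shows "n = 24" and "card C = 4096" and "\<And>c. c \<in> C \<Longrightarrow> card c \<in> {0, 8, 12, 16, 24}"
    and "\<exists>c\<in>C. card c = 12"
proof -
  have n: "9 \<le> n" and ge5: "\<And>u. u \<in> weights \<Longrightarrow> 5 \<le> u"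
    using three_weights_ge_5 [OF v three] by auto
  have compl: "vadd {..<n} c \<in> C" "card (vadd {..<n} c) = n - card c" if "c \<in> C" for c
  proof -
    show "vadd {..<n} c \<in> C"
      using that ones vadd_mem by blast
    have "vadd {..<n} c = {..<n} - c"
      using subset [OF that] by (auto simp: vadd_def)
    then show "card (vadd {..<n} c) = n - card c"
      using subset [OF that] finite_word [OF that] by (simp add: card_Diff_subset)
  qed
  have le_n: "card c \<le> n" if "c \<in> C" for c
    using card_mono [OF _ subset [OF that]] by simp
  \<comment> \<open>The bound \<open>5 \<le> u\<close> is what keeps the complementary weight at
    most \<open>n - 5\<close>.\<close>
  have refl: "n - u \<in> weights" if u: "u \<in> weights" for u
  proof -
    obtain c where "c \<in> C" "card c = u"
      using u by (auto simp: weight_class_def)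
    then show ?thesis
      using compl [of c] u ge5 [OF u] n by (auto simp: weight_class_def)
  qed
  \<comment> \<open>A weight strictly between \<open>n - 5\<close> and \<open>n\<close> would have a
    complementary weight below 5.\<close>
  have weight_cases: "card c \<in> insert 0 (insert n weights)" if c: "c \<in> C" for c
  proof (rule ccontr)
    assume *: "card c \<notin> insert 0 (insert n weights)"
    then have "n - 5 < card c"
      using c by (auto simp: weight_class_def)
    then have "n - card c \<in> weights"
      using * compl [OF c] le_n [OF c] n by (auto simp: weight_class_def)
    then show False
      using ge5 [of "n - card c"] \<open>n - 5 < card c\<close> n by linarith
  qed
  obtain a b c where abc: "weights = {a, b, c}" "a < b" "b < c"
  proof -
    obtain x y z where "weights = {x, y, z}" "x \<noteq> y" "x \<noteq> z" "y \<noteq> z"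
      using three by (auto simp: card_3_iff)
    then show ?thesis
      using that [of x y z] that [of x z y] that [of y x z] that [of y z x] that [of z x y] that [of z y x]
      by (metis insert_commute linorder_neqE_nat)
  qed
  have bounds: "5 \<le> a" "c \<le> n - 5"
    using abc ge5 by auto
  have "n - a \<in> {a, b, c}" "n - b \<in> {a, b, c}" "n - c \<in> {a, b, c}"
    using refl unfolding abc(1) by auto
  \<comment> \<open>Complementing reverses the order of the three weights, so it fixes the middle
    one.\<close>
  then have b: "n = 2 * b" and c: "c = n - a"
    using abc(2,3) bounds by auto
  define N where "N = real (card C)"
  define x where "x = real n"
  define y where "y w = (x - 2 * real (card w)) ^ 2" for w :: "nat set"
  define s where "s = (x - 2 * real a) ^ 2"
  have y_cases: "y w = 0 \<or> y w = s" if "w \<in> C - {{}, {..<n}}" for w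
  proof -
    have "card w \<noteq> 0" "card w \<noteq> n"
      using that subset finite_word card_subset_eq [of "{..<n}" w] by auto
    then have "card w \<in> {a, b, n - a}"
      using weight_cases [of w] that abc(1) c by auto
    then consider "card w = a" | "card w = b" | "card w = n - a"
      by auto
    then show ?thesis
    proof cases
      case 3
      then have "real (card w) = x - a"
        using abc b by (simp add: x_def of_nat_diff)
      then have "x - 2 * real (card w) = - (x - 2 * real a)"
        by simp
      then have "y w = s"
        by (simp only: y_def s_def power2_minus)
      then show ?thesis ..
    qed (use b in \<open>auto simp: y_def s_def x_def\<close>)
  qed
  \<comment> \<open>It will be applied to \<open>y (y - s)\<close> and
    \<open>y\<^sup>2 (y - s)\<close>, which vanish on every word except the zero word and the
    all-ones word.\<close>
  have split: "(\<Sum>w\<in>C. g w) = g {} + g {..<n}" if "\<And>w. w \<in> C - {{}, {..<n}} \<Longrightarrow> g w = 0" for g :: "nat set \<Rightarrow> real"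
  proof -
    have "(\<Sum>w\<in>C. g w) = (\<Sum>w\<in>{{}, {..<n}}. g w)"
      using that ones empty_mem finite_code by (intro sum.mono_neutral_right) auto
    also have "\<dots> = g {} + g {..<n}"
      using n lessThan_empty_iff [of n] by (subst sum.insert) auto
    finally show ?thesis .
  qed
  have y_ends: "y {} = x ^ 2" "y {..<n} = x ^ 2"
    by (simp_all add: y_def x_def)
  have moments: "(\<Sum>w\<in>C. y w) = x * N" "(\<Sum>w\<in>C. y w ^ 2) = (3 * x ^ 2 - 2 * x) * N"
    "(\<Sum>w\<in>C. y w ^ 3) = (15 * x ^ 3 - 30 * x ^ 2 + 16 * x) * N"
    using even_power_moments by (simp_all add: y_def x_def N_def flip: power_mult)
  have "(\<Sum>w\<in>C. y w ^ 2 - s * y w) = 2 * x ^ 2 * (x ^ 2 - s)"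
    by (subst split) (use y_cases in \<open>auto simp: y_ends power2_eq_square algebra_simps\<close>)
  then have eq1: "2 * x ^ 2 * (x ^ 2 - s) = (3 * x ^ 2 - 2 * x - s * x) * N"
    using moments by (simp add: sum_subtractf flip: sum_distrib_left) algebra
  have "(\<Sum>w\<in>C. y w ^ 3 - s * y w ^ 2) = 2 * x ^ 4 * (x ^ 2 - s)"
    by (subst split) (use y_cases in \<open>auto simp: y_ends power2_eq_square power3_eq_cube power4_eq_xxxx algebra_simps\<close>)
  then have eq2: "2 * x ^ 4 * (x ^ 2 - s) = (15 * x ^ 3 - 30 * x ^ 2 + 16 * x - s * (3 * x ^ 2 - 2 * x)) * N"
    using moments by (simp add: sum_subtractf flip: sum_distrib_left) algebra
  have x9: "9 \<le> x" and N0: "N \<noteq> 0"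
    using n empty_mem finite_code by (auto simp: x_def N_def)
  \<comment> \<open>Take \<open>x\<^sup>2\<close> times the first equation minus the second; the
    left sides cancel and the difference factors.\<close>
  have "x * N * ((x - 1) * (x - 2)) * (s - (3 * x - 8)) = 0"
    using eq1 eq2 by algebra
  then have s: "s = 3 * x - 8"
    using x9 N0 by simp
  have "2 * x * (x * (x ^ 2 - 3 * x + 8) - 3 * N) = 0"
    using eq1 unfolding s by algebra
  then have "x * (x ^ 2 - 3 * x + 8) = 3 * N"
    using x9 by simp
  then have eq: "real (n ^ 3 + 8 * n) = real (3 * card C + 3 * n ^ 2)"
    unfolding x_def N_def of_nat_add of_nat_mult of_nat_power of_nat_numeral by algebra
  then have eq': "n ^ 3 + 8 * n = 3 * card C + 3 * n ^ 2"
    by (simp only: of_nat_eq_iff)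
  show n24: "n = 24"
    using golay_length_equation [OF n, of k] eq' size by simp
  then show "card C = 4096"
    using eq' by simp
  \<comment> \<open>Here 64 is 3 * 24 - 8; the positive root is the right one because
    \<open>a\<close> lies below the middle weight.\<close>
  have "(x - 2 * real a) ^ 2 = 8 ^ 2"
    using s n24 unfolding s_def by (simp add: x_def)
  moreover have "0 \<le> x - 2 * real a"
    using abc(2) b by (simp add: x_def)
  ultimately have "x - 2 * real a = 8"
    by (simp only: power2_eq_iff_nonneg)
  then have "a = 8"
    using n24 by (simp add: x_def)
  then show "card c \<in> {0, 8, 12, 16, 24}" if "c \<in> C" for c
    using weight_cases [OF that] abc(1) b c n24 by auto
  have "b \<in> weights"
    using abc(1) by simp
  then show "\<exists>c\<in>C. card c = 12"
    using b n24 by (auto simp: weight_class_def)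
qed

end

subsection \<open>The biplane on 11 points\<close>

lemma card_filter_set:
  assumes "distinct xs"
  shows "card {x \<in> set xs. P x} = (\<Sum>x\<leftarrow>xs. of_bool (P x))"
  using assms
proof (induction xs)
  case (Cons a xs)
  have "{x \<in> set (a # xs). P x} = (if P a then insert a {x \<in> set xs. P x} else {x \<in> set xs. P x})"
    by auto
  then show ?case
    using Cons by simp
qed simp

text \<open>The right side is a conjunctive normal form, suited to \<open>sat\<close>: among any
  three variables one holds and one fails.\<close>

lemma two_of_four:
  "of_bool a + of_bool b + of_bool c + of_bool d = (2::nat) \<longleftrightarrow>
    (a \<or> b \<or> c) \<and> (a \<or> b \<or> d) \<and> (a \<or> c \<or> d) \<and> (b \<or> c \<or> d) \<and>
    (\<not> a \<or> \<not> b \<or> \<not> c) \<and> (\<not> a \<or> \<not> b \<or> \<not> d) \<and> (\<not> a \<or> \<not> c \<or> \<not> d) \<and> (\<not> b \<or> \<not> c \<or> \<not> d)"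
  by (cases a; cases b; cases c; cases d) simp_all

text \<open>Splitting on \<open>e\<close> reduces the count to four summands, for which clauses are
  available.\<close>

lemma two_of_five:
  "of_bool a + of_bool b + of_bool c + of_bool d + of_bool e = (2::nat) \<longleftrightarrow>
    (e \<longrightarrow> of_bool a + of_bool b + of_bool c + of_bool d = (1::nat)) \<and>
    (\<not> e \<longrightarrow> of_bool a + of_bool b + of_bool c + of_bool d = (2::nat))"
  by (cases e) simp_all

lemma one_of_four:
  "of_bool a + of_bool b + of_bool c + of_bool d = (1::nat) \<longleftrightarrow>
    (a \<or> b \<or> c \<or> d) \<and> \<not> (a \<and> b) \<and> \<not> (a \<and> c) \<and> \<not> (a \<and> d) \<and> \<not> (b \<and> c) \<and> \<not> (b \<and> d) \<and> \<not> (c \<and> d)"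
  by (cases a; cases b; cases c; cases d) simp_all

text \<open>\<open>pij\<close> stands for the edge between vertices \<open>i\<close> and
  \<open>j\<close>, and the hypotheses are the vertex degrees. Five vertices leave no room for two
  disjoint cycles, so the graph is one of the 4!/2 = 12 Hamiltonian cycles.\<close>

lemma two_regular_graph_5_cases:
  assumes "of_bool p01 + of_bool p02 + of_bool p03 + of_bool p04 = (2::nat)"
    and "of_bool p01 + of_bool p12 + of_bool p13 + of_bool p14 = (2::nat)"
    and "of_bool p02 + of_bool p12 + of_bool p23 + of_bool p24 = (2::nat)"
    and "of_bool p03 + of_bool p13 + of_bool p23 + of_bool p34 = (2::nat)"
    and "of_bool p04 + of_bool p14 + of_bool p24 + of_bool p34 = (2::nat)"
  shows "(p01 \<and> p12 \<and> p23 \<and> p34 \<and> p04) \<or>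
     (p01 \<and> p12 \<and> p24 \<and> p34 \<and> p03) \<or>
     (p01 \<and> p13 \<and> p23 \<and> p24 \<and> p04) \<or>
     (p01 \<and> p13 \<and> p34 \<and> p24 \<and> p02) \<or>
     (p01 \<and> p14 \<and> p24 \<and> p23 \<and> p03) \<or>
     (p01 \<and> p14 \<and> p34 \<and> p23 \<and> p02) \<or>
     (p02 \<and> p12 \<and> p13 \<and> p34 \<and> p04) \<or>
     (p02 \<and> p12 \<and> p14 \<and> p34 \<and> p03) \<or>
     (p02 \<and> p23 \<and> p13 \<and> p14 \<and> p04) \<or>
     (p02 \<and> p24 \<and> p14 \<and> p13 \<and> p03) \<or>
     (p03 \<and> p13 \<and> p12 \<and> p24 \<and> p04) \<or>
     (p03 \<and> p23 \<and> p12 \<and> p14 \<and> p04)"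
  using assms unfolding two_of_four by sat

text \<open>The last hypothesis counts the edges shared with the pentagon 0-1-2-3-4. The two shared
  edges are necessarily disjoint, and each of the five disjoint pairs extends in one way. Edges are
  in lexicographic order.\<close>

lemma pentagon_sharing_two_edges_cases:
  assumes "of_bool p01 + of_bool p02 + of_bool p03 + of_bool p04 = (2::nat)"
    and "of_bool p01 + of_bool p12 + of_bool p13 + of_bool p14 = (2::nat)"
    and "of_bool p02 + of_bool p12 + of_bool p23 + of_bool p24 = (2::nat)"
    and "of_bool p03 + of_bool p13 + of_bool p23 + of_bool p34 = (2::nat)"
    and "of_bool p04 + of_bool p14 + of_bool p24 + of_bool p34 = (2::nat)"
    and "of_bool p01 + of_bool p12 + of_bool p23 + of_bool p34 + of_bool p04 = (2::nat)"
  shows "[p01, p02, p03, p04, p12, p13, p14, p23, p24, p34] \<in> set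
     [[True, True, False, False, False, True, False, False, True, True],
      [True, False, True, False, False, False, True, True, True, False],
      [False, True, True, False, True, False, True, False, False, True],
      [False, True, False, True, False, True, True, True, False, False],
      [False, False, True, True, True, True, False, False, True, False]]"
  using assms
  unfolding two_of_five one_of_four two_of_four list.set insert_iff empty_iff list.inject simp_thms
  by sat

lemma two_regular_graph_5_pentagon:
  assumes "card A = 5" and sym: "\<And>r s. e r s \<longleftrightarrow> e s r"
    and deg: "\<And>r. r \<in> A \<Longrightarrow> card {s \<in> A. s \<noteq> r \<and> e r s} = 2"
  shows "\<exists>a0 a1 a2 a3 a4. distinct [a0, a1, a2, a3, a4] \<and> set [a0, a1, a2, a3, a4] = A
    \<and> e a0 a1 \<and> e a1 a2 \<and> e a2 a3 \<and> e a3 a4 \<and> e a4 a0"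
proof -
  have "finite A"
    using assms(1) card_gt_0_iff [of A] by simp
  then obtain bs where "distinct bs" "set bs = A" "length bs = 5"
    using finite_distinct_list distinct_card assms(1) by metis
  then obtain b0 b1 b2 b3 b4 where b: "distinct [b0, b1, b2, b3, b4]" "set [b0, b1, b2, b3, b4] = A"
    by (auto simp: numeral_eq_Suc length_Suc_conv)
  have sums: "of_bool (e r s1) + of_bool (e r s2) + of_bool (e r s3) + of_bool (e r s4) = (2::nat)"
    if "distinct [r, s1, s2, s3, s4]" "set [r, s1, s2, s3, s4] = A" for r s1 s2 s3 s4
  proof -
    have "{s \<in> A. s \<noteq> r \<and> e r s} = {s \<in> set [s1, s2, s3, s4]. e r s}"
      using that by auto
    then have "card {s \<in> set [s1, s2, s3, s4]. e r s} = 2"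
      using deg [of r] that by auto
    then show ?thesis
      using that(1) by (subst (asm) card_filter_set) simp_all
  qed
  have "of_bool (e b0 b1) + of_bool (e b0 b2) + of_bool (e b0 b3) + of_bool (e b0 b4) = (2::nat)"
    by (rule sums) (use b in auto)
  moreover have "of_bool (e b1 b0) + of_bool (e b1 b2) + of_bool (e b1 b3) + of_bool (e b1 b4) = (2::nat)"
    by (rule sums) (use b in auto)
  moreover have "of_bool (e b2 b0) + of_bool (e b2 b1) + of_bool (e b2 b3) + of_bool (e b2 b4) = (2::nat)"
    by (rule sums) (use b in auto)
  moreover have "of_bool (e b3 b0) + of_bool (e b3 b1) + of_bool (e b3 b2) + of_bool (e b3 b4) = (2::nat)"
    by (rule sums) (use b in auto)
  moreover have "of_bool (e b4 b0) + of_bool (e b4 b1) + of_bool (e b4 b2) + of_bool (e b4 b3) = (2::nat)"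
    by (rule sums) (use b in auto)
  ultimately have cases: "(e b0 b1 \<and> e b1 b2 \<and> e b2 b3 \<and> e b3 b4 \<and> e b0 b4) \<or>
     (e b0 b1 \<and> e b1 b2 \<and> e b2 b4 \<and> e b3 b4 \<and> e b0 b3) \<or>
     (e b0 b1 \<and> e b1 b3 \<and> e b2 b3 \<and> e b2 b4 \<and> e b0 b4) \<or>
     (e b0 b1 \<and> e b1 b3 \<and> e b3 b4 \<and> e b2 b4 \<and> e b0 b2) \<or>
     (e b0 b1 \<and> e b1 b4 \<and> e b2 b4 \<and> e b2 b3 \<and> e b0 b3) \<or>
     (e b0 b1 \<and> e b1 b4 \<and> e b3 b4 \<and> e b2 b3 \<and> e b0 b2) \<or>
     (e b0 b2 \<and> e b1 b2 \<and> e b1 b3 \<and> e b3 b4 \<and> e b0 b4) \<or>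
     (e b0 b2 \<and> e b1 b2 \<and> e b1 b4 \<and> e b3 b4 \<and> e b0 b3) \<or>
     (e b0 b2 \<and> e b2 b3 \<and> e b1 b3 \<and> e b1 b4 \<and> e b0 b4) \<or>
     (e b0 b2 \<and> e b2 b4 \<and> e b1 b4 \<and> e b1 b3 \<and> e b0 b3) \<or>
     (e b0 b3 \<and> e b1 b3 \<and> e b1 b2 \<and> e b2 b4 \<and> e b0 b4) \<or>
     (e b0 b3 \<and> e b2 b3 \<and> e b1 b2 \<and> e b1 b4 \<and> e b0 b4)"
    unfolding sym [of b1 b0] sym [of b2 b0] sym [of b3 b0] sym [of b4 b0] sym [of b2 b1] sym [of b3 b1]
      sym [of b4 b1] sym [of b3 b2] sym [of b4 b2] sym [of b4 b3]
    by (rule two_regular_graph_5_cases)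
  have cycle: ?thesis
    if "distinct [c0, c1, c2, c3, c4]" "set [c0, c1, c2, c3, c4] = A"
      "e c0 c1 \<and> e c1 c2 \<and> e c2 c3 \<and> e c3 c4 \<and> e c4 c0" for c0 c1 c2 c3 c4
    using that by blast
  from cases show ?thesis
    apply (elim disjE)
    subgoal by (rule cycle [of b0 b1 b2 b3 b4]) (use b in \<open>auto simp: sym\<close>)
    subgoal by (rule cycle [of b0 b1 b2 b4 b3]) (use b in \<open>auto simp: sym\<close>)
    subgoal by (rule cycle [of b0 b1 b3 b2 b4]) (use b in \<open>auto simp: sym\<close>)
    subgoal by (rule cycle [of b0 b1 b3 b4 b2]) (use b in \<open>auto simp: sym\<close>)
    subgoal by (rule cycle [of b0 b1 b4 b2 b3]) (use b in \<open>auto simp: sym\<close>)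
    subgoal by (rule cycle [of b0 b1 b4 b3 b2]) (use b in \<open>auto simp: sym\<close>)
    subgoal by (rule cycle [of b0 b2 b1 b3 b4]) (use b in \<open>auto simp: sym\<close>)
    subgoal by (rule cycle [of b0 b2 b1 b4 b3]) (use b in \<open>auto simp: sym\<close>)
    subgoal by (rule cycle [of b0 b2 b3 b1 b4]) (use b in \<open>auto simp: sym\<close>)
    subgoal by (rule cycle [of b0 b2 b4 b1 b3]) (use b in \<open>auto simp: sym\<close>)
    subgoal by (rule cycle [of b0 b3 b1 b2 b4]) (use b in \<open>auto simp: sym\<close>)
    subgoal by (rule cycle [of b0 b3 b2 b1 b4]) (use b in \<open>auto simp: sym\<close>)
    done
qed

lemma card_2_other:
  assumes "card X = 2"
  obtains y where "y \<in> X" "y \<noteq> x"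
  using assms by (auto simp: card_2_iff)

section \<open>Biplanes with 11 points and blocks of size 5\<close>

locale biplane_11 =
  fixes D :: "'a set" and E :: "'b set" and B :: "'a \<Rightarrow> 'b set"
  assumes card_D: "card D = 11" and card_E: "card E = 11"
    and block_sub: "j \<in> D \<Longrightarrow> B j \<subseteq> E"
    and card_block: "j \<in> D \<Longrightarrow> card (B j) = 5"
    and card_block_Int: "j \<in> D \<Longrightarrow> j' \<in> D \<Longrightarrow> j \<noteq> j' \<Longrightarrow> card (B j \<inter> B j') = 2"
    and card_point: "x \<in> E \<Longrightarrow> card {j \<in> D. x \<in> B j} = 5"
    and card_two_points: "x \<in> E \<Longrightarrow> y \<in> E \<Longrightarrow> x \<noteq> y \<Longrightarrow> card {j \<in> D. x \<in> B j \<and> y \<in> B j} = 2"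
begin

lemma finite_D: "finite D" and finite_E: "finite E"
  using card_D card_E card_gt_0_iff [of D] card_gt_0_iff [of E] by simp_all

text \<open>Two points of block \<open>b\<close> lie in exactly one further block, so the other ten
  blocks correspond to the edges of the complete graph on the points of \<open>b\<close>.\<close>

definition other_block :: "'a \<Rightarrow> 'b \<Rightarrow> 'b \<Rightarrow> 'a" where
  "other_block b r s = (SOME j. j \<in> D \<and> j \<noteq> b \<and> r \<in> B j \<and> s \<in> B j)"

context
  fixes b assumes b: "b \<in> D"
begin

lemma other_block_exists:
  assumes "r \<in> B b" "s \<in> B b" "r \<noteq> s"
  shows "other_block b r s \<in> D" "other_block b r s \<noteq> b"
    and "r \<in> B (other_block b r s)" "s \<in> B (other_block b r s)"
    and "B (other_block b r s) \<inter> B b = {r, s}"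
proof -
  have "card {j \<in> D. r \<in> B j \<and> s \<in> B j} = 2"
    using assms b block_sub card_two_points by blast
  then have "\<exists>j. j \<in> D \<and> j \<noteq> b \<and> r \<in> B j \<and> s \<in> B j"
    by (rule card_2_other [of _ b]) auto
  then have *: "other_block b r s \<in> D \<and> other_block b r s \<noteq> b \<and> r \<in> B (other_block b r s) \<and> s \<in> B (other_block b r s)"
    unfolding other_block_def by (rule someI_ex)
  then show "other_block b r s \<in> D" "other_block b r s \<noteq> b"
    "r \<in> B (other_block b r s)" "s \<in> B (other_block b r s)"
    by auto
  have card: "card (B (other_block b r s) \<inter> B b) = 2"
    using * b card_block_Int by blast
  have "{r, s} = B (other_block b r s) \<inter> B b"
  proof (rule card_subset_eq)
    show "finite (B (other_block b r s) \<inter> B b)"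
      using b block_sub finite_E finite_subset by blast
  qed (use * assms card in auto)
  then show "B (other_block b r s) \<inter> B b = {r, s}" ..
qed

lemma other_block_unique:
  assumes "j \<in> D" "j \<noteq> b" "r \<in> B b" "s \<in> B b" "r \<noteq> s" "r \<in> B j" "s \<in> B j"
  shows "other_block b r s = j"
proof (rule ccontr)
  assume *: "other_block b r s \<noteq> j"
  have "card {j \<in> D. r \<in> B j \<and> s \<in> B j} = 2"
    using assms b block_sub card_two_points by blast
  moreover have "card {b, j, other_block b r s} \<le> card {j \<in> D. r \<in> B j \<and> s \<in> B j}"
    using assms b other_block_exists [of r s] finite_D by (intro card_mono) auto
  moreover have "card {b, j, other_block b r s} = 3"
    using * assms other_block_exists(2) [of r s] by auto
  ultimately show False
    by simp
qed

lemma other_block_commute: "other_block b r s = other_block b s r"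
  unfolding other_block_def by (rule arg_cong [where f = Eps]) auto

text \<open>The point \<open>q\<close> defines a graph on block \<open>b\<close>, with an edge
  \<open>r s\<close> when \<open>q\<close> lies on the further block through \<open>r\<close> and
  \<open>s\<close>. Each of the two blocks through \<open>r\<close> and \<open>q\<close> meets
  \<open>b\<close> in \<open>r\<close> and one neighbour of \<open>r\<close>.\<close>

lemma card_neighbours:
  assumes q: "q \<in> E - B b" and r: "r \<in> B b"
  shows "card {s \<in> B b. s \<noteq> r \<and> q \<in> B (other_block b r s)} = 2"
proof -
  have "bij_betw (other_block b r) {s \<in> B b. s \<noteq> r \<and> q \<in> B (other_block b r s)} {j \<in> D. r \<in> B j \<and> q \<in> B j}"
    unfolding bij_betw_def
  proof
    show "inj_on (other_block b r) {s \<in> B b. s \<noteq> r \<and> q \<in> B (other_block b r s)}"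
    proof (rule inj_onI)
      fix s s'
      assume "s \<in> {s \<in> B b. s \<noteq> r \<and> q \<in> B (other_block b r s)}"
        "s' \<in> {s \<in> B b. s \<noteq> r \<and> q \<in> B (other_block b r s)}"
        "other_block b r s = other_block b r s'"
      then show "s = s'"
        using other_block_exists(5) [of r s] other_block_exists(5) [of r s'] r by auto
    qed
    show "other_block b r ` {s \<in> B b. s \<noteq> r \<and> q \<in> B (other_block b r s)} = {j \<in> D. r \<in> B j \<and> q \<in> B j}"
    proof (intro equalityI subsetI)
      fix j assume j: "j \<in> {j \<in> D. r \<in> B j \<and> q \<in> B j}"
      then have "j \<noteq> b"
        using q by auto
      then have "card (B j \<inter> B b) = 2"
        using j b card_block_Int by blast
      then obtain s where "s \<in> B j \<inter> B b" "s \<noteq> r"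
        by (rule card_2_other [of _ r])
      then have "other_block b r s = j"
        using j r \<open>j \<noteq> b\<close> by (intro other_block_unique) auto
      then show "j \<in> other_block b r ` {s \<in> B b. s \<noteq> r \<and> q \<in> B (other_block b r s)}"
        using j \<open>s \<noteq> r\<close> \<open>s \<in> B j \<inter> B b\<close> by (intro image_eqI [of _ _ s]) auto
    qed (use r other_block_exists in auto)
  qed
  moreover have "card {j \<in> D. r \<in> B j \<and> q \<in> B j} = 2"
    using q r block_sub [OF b] by (intro card_two_points) auto
  ultimately show ?thesis
    using bij_betw_same_card by fastforce
qed

end

end

text \<open>Points 0 to 4 form block 0, the other blocks are listed by the pair of these points that they
  contain, and points 5 to 10 are the pentagons, point 5 being 0-1-2-3-4.\<close>

definition biplane_table :: "nat list list" where
  "biplane_table =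
   [[0, 1, 2, 3, 4],
    [0, 1, 5, 6, 7],
    [0, 2, 6, 8, 9],
    [0, 3, 7, 8, 10],
    [0, 4, 5, 9, 10],
    [1, 2, 5, 8, 10],
    [1, 3, 6, 9, 10],
    [1, 4, 7, 8, 9],
    [2, 3, 5, 7, 9],
    [2, 4, 6, 7, 10],
    [3, 4, 5, 6, 8]]"

context biplane_11
begin

text \<open>One outside point \<open>q0\<close> orders the points of the block along its pentagon.
  The other five outside points are distinct pentagons sharing two edges with it; as only five
  exist, all occur and every incidence is forced.\<close>

lemma biplane_enumeration:
  shows "\<exists>ds es. distinct ds \<and> set ds = D \<and> length ds = 11 \<and> distinct es \<and> set es = E \<and> length es = 11 \<and>
    (\<forall>i<11. B (ds ! i) = (!) es ` set (biplane_table ! i))"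
proof -
  have "D \<noteq> {}"
    using card_D by auto
  then obtain b where b: "b \<in> D"
    by blast
  define A where "A = B b"
  have A: "A \<subseteq> E" "card A = 5" "finite A"
    using b block_sub card_block finite_E finite_subset unfolding A_def by metis+
  have card_Q: "card (E - A) = 6"
    using A card_E by (simp add: card_Diff_subset)
  then have "E - A \<noteq> {}"
    by (metis card.empty zero_neq_numeral)
  then obtain q0 where q0: "q0 \<in> E - A"
    by blast
  define J where "J = other_block b"
  have J_D: "J r s \<in> D" "J r s \<noteq> b" and J_Int: "B (J r s) \<inter> A = {r, s}"
    if "r \<in> A" "s \<in> A" "r \<noteq> s" for r s
    using other_block_exists [OF b, of r s] that unfolding J_def A_def by auto
  have "\<exists>a0 a1 a2 a3 a4. distinct [a0, a1, a2, a3, a4] \<and> set [a0, a1, a2, a3, a4] = A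
    \<and> q0 \<in> B (J a0 a1) \<and> q0 \<in> B (J a1 a2) \<and> q0 \<in> B (J a2 a3) \<and> q0 \<in> B (J a3 a4) \<and> q0 \<in> B (J a4 a0)"
  proof (rule two_regular_graph_5_pentagon [OF A(2)])
    show "q0 \<in> B (J r s) \<longleftrightarrow> q0 \<in> B (J s r)" for r s
      unfolding J_def using other_block_commute [OF b] by metis
    show "card {s \<in> A. s \<noteq> r \<and> q0 \<in> B (J r s)} = 2" if "r \<in> A" for r
      using card_neighbours [OF b] q0 that unfolding J_def A_def by blast
  qed
  then obtain a0 a1 a2 a3 a4 where a: "distinct [a0, a1, a2, a3, a4]" "set [a0, a1, a2, a3, a4] = A"
    and q0_edges: "q0 \<in> B (J a0 a1)" "q0 \<in> B (J a1 a2)" "q0 \<in> B (J a2 a3)" "q0 \<in> B (J a3 a4)" "q0 \<in> B (J a4 a0)"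
    by blast
  have "J a4 a0 = J a0 a4"
    unfolding J_def by (rule other_block_commute [OF b])
  note q0_edges = q0_edges [unfolded this]
  have in_A: "a0 \<in> A" "a1 \<in> A" "a2 \<in> A" "a3 \<in> A" "a4 \<in> A"
    using a(2) by auto
  have ne: "a0 \<noteq> a1" "a0 \<noteq> a2" "a0 \<noteq> a3" "a0 \<noteq> a4" "a1 \<noteq> a2" "a1 \<noteq> a3" "a1 \<noteq> a4" "a2 \<noteq> a3" "a2 \<noteq> a4" "a3 \<noteq> a4"
    using a(1) by auto
  have J_mem: "x \<in> B (J r s) \<longleftrightarrow> x = r \<or> x = s" if "x \<in> A" "r \<in> A" "s \<in> A" "r \<noteq> s" for x r s
    using J_Int [OF that(2-)] that(1) by blast
  have J_eq: "J r s = J r' s' \<longleftrightarrow> r = r' \<and> s = s' \<or> r = s' \<and> s = r'"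
    if "r \<in> A" "s \<in> A" "r \<noteq> s" "r' \<in> A" "s' \<in> A" "r' \<noteq> s'" for r s r' s'
  proof
    assume "J r s = J r' s'"
    then show "r = r' \<and> s = s' \<or> r = s' \<and> s = r'"
      using J_Int [of r s] J_Int [of r' s'] that by (auto simp: doubleton_eq_iff)
  qed (auto simp: J_def other_block_commute [OF b])
  \<comment> \<open>The lexicographic order of pairs agrees with the rows of
    \<open>biplane_table\<close> and with the truth vectors in \<open>pats\<close>.\<close>
  define js where "js = [J a0 a1, J a0 a2, J a0 a3, J a0 a4, J a1 a2, J a1 a3, J a1 a4, J a2 a3, J a2 a4, J a3 a4]"
  have dist: "distinct (b # js)"
    unfolding js_def using ne in_A J_D(2) J_D(2) [symmetric] by (simp add: J_eq)
  have "set (b # js) = D"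
  proof (rule card_subset_eq [OF finite_D])
    show "set (b # js) \<subseteq> D"
      unfolding js_def using b ne in_A J_D(1) by simp
    show "card (set (b # js)) = card D"
      using distinct_card [OF dist] card_D by (simp add: js_def)
  qed
  then have count: "card {j \<in> D. P j} = (\<Sum>j\<leftarrow>b # js. of_bool (P j))" for P
    using card_filter_set [OF dist, of P] by simp
  have b_mem: "x \<in> B b \<longleftrightarrow> x \<in> A" for x
    by (simp add: A_def)
  have deg: "of_bool (q \<in> B (J a0 a1)) + of_bool (q \<in> B (J a0 a2)) + of_bool (q \<in> B (J a0 a3)) + of_bool (q \<in> B (J a0 a4)) = (2::nat)"
    "of_bool (q \<in> B (J a0 a1)) + of_bool (q \<in> B (J a1 a2)) + of_bool (q \<in> B (J a1 a3)) + of_bool (q \<in> B (J a1 a4)) = (2::nat)"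
    "of_bool (q \<in> B (J a0 a2)) + of_bool (q \<in> B (J a1 a2)) + of_bool (q \<in> B (J a2 a3)) + of_bool (q \<in> B (J a2 a4)) = (2::nat)"
    "of_bool (q \<in> B (J a0 a3)) + of_bool (q \<in> B (J a1 a3)) + of_bool (q \<in> B (J a2 a3)) + of_bool (q \<in> B (J a3 a4)) = (2::nat)"
    "of_bool (q \<in> B (J a0 a4)) + of_bool (q \<in> B (J a1 a4)) + of_bool (q \<in> B (J a2 a4)) + of_bool (q \<in> B (J a3 a4)) = (2::nat)"
    if q: "q \<in> E - A" for q
  proof -
    \<comment> \<open>Two blocks contain \<open>x\<close> and \<open>q\<close>; since
      \<open>b\<close> misses \<open>q\<close>, both are among the four further blocks through
      \<open>x\<close>.\<close>
    have *: "(\<Sum>j\<leftarrow>b # js. of_bool (x \<in> B j \<and> q \<in> B j)) = (2::nat)" if "x \<in> A" for x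
      unfolding count [symmetric] using that q A(1) by (intro card_two_points) auto
    show "of_bool (q \<in> B (J a0 a1)) + of_bool (q \<in> B (J a0 a2)) + of_bool (q \<in> B (J a0 a3)) + of_bool (q \<in> B (J a0 a4)) = (2::nat)"
      "of_bool (q \<in> B (J a0 a1)) + of_bool (q \<in> B (J a1 a2)) + of_bool (q \<in> B (J a1 a3)) + of_bool (q \<in> B (J a1 a4)) = (2::nat)"
      "of_bool (q \<in> B (J a0 a2)) + of_bool (q \<in> B (J a1 a2)) + of_bool (q \<in> B (J a2 a3)) + of_bool (q \<in> B (J a2 a4)) = (2::nat)"
      "of_bool (q \<in> B (J a0 a3)) + of_bool (q \<in> B (J a1 a3)) + of_bool (q \<in> B (J a2 a3)) + of_bool (q \<in> B (J a3 a4)) = (2::nat)"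
      "of_bool (q \<in> B (J a0 a4)) + of_bool (q \<in> B (J a1 a4)) + of_bool (q \<in> B (J a2 a4)) + of_bool (q \<in> B (J a3 a4)) = (2::nat)"
      using * [OF in_A(1)] * [OF in_A(2)] * [OF in_A(3)] * [OF in_A(4)] * [OF in_A(5)] q in_A ne
      unfolding js_def by (simp_all add: J_mem b_mem)
  qed
  have q0_non: "q0 \<notin> B (J a0 a2)"
    "q0 \<notin> B (J a0 a3)"
    "q0 \<notin> B (J a1 a3)"
    "q0 \<notin> B (J a1 a4)"
    "q0 \<notin> B (J a2 a4)"
    using deg [OF q0] q0_edges by simp_all
  define p where "p q = map (\<lambda>j. q \<in> B j) js" for q
  define pats where "pats = [[True, True, False, False, False, True, False, False, True, True],
      [True, False, True, False, False, False, True, True, True, False],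
      [False, True, True, False, True, False, True, False, False, True],
      [False, True, False, True, False, True, True, True, False, False],
      [False, False, True, True, True, True, False, False, True, False]]"
  have p_in: "p q \<in> set pats" if q: "q \<in> E - A - {q0}" for q
  proof -
    \<comment> \<open>The blocks through \<open>q0\<close> are exactly the edges of its pentagon, so
      common blocks are common edges.\<close>
    have "(\<Sum>j\<leftarrow>b # js. of_bool (q0 \<in> B j \<and> q \<in> B j)) = (2::nat)"
      unfolding count [symmetric] using q q0 by (intro card_two_points) auto
    then have "of_bool (q \<in> B (J a0 a1)) + of_bool (q \<in> B (J a1 a2)) + of_bool (q \<in> B (J a2 a3)) + of_bool (q \<in> B (J a3 a4)) + of_bool (q \<in> B (J a0 a4)) = (2::nat)"
      using q0 q0_edges q0_non unfolding js_def by (simp add: b_mem)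
    then show ?thesis
      unfolding p_def js_def pats_def list.map
      using q by (intro pentagon_sharing_two_edges_cases deg) auto
  qed
  have p_inj: "inj_on p (E - A - {q0})"
  proof (rule inj_onI, rule ccontr)
    fix q q' assume q: "q \<in> E - A - {q0}" "q' \<in> E - A - {q0}" "p q = p q'" "q \<noteq> q'"
    \<comment> \<open>Equal patterns would give the two points five common blocks instead of
      two.\<close>
    then have "{j \<in> D. q \<in> B j} = {j \<in> D. q \<in> B j \<and> q' \<in> B j}"
      using \<open>set (b # js) = D\<close> by (auto simp: p_def b_mem)
    then show False
      using card_point [of q] card_two_points [of q q'] q by simp
  qed
  have p_image: "p ` (E - A - {q0}) = set pats"
  proof (rule card_subset_eq)
    have "card (set pats) = 5"
      by (simp add: pats_def)
    then show "card (p ` (E - A - {q0})) = card (set pats)"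
      using card_image [OF p_inj] card_Q q0 finite_E by simp
  qed (use p_in in auto)
  have pats_im: "\<exists>q. q \<in> E - A - {q0} \<and> p q = z" if "z \<in> set pats" for z
  proof -
    have "z \<in> p ` (E - A - {q0})"
      using that p_image by simp
    then show ?thesis
      by auto
  qed
  have pats_mem: "[True, True, False, False, False, True, False, False, True, True] \<in> set pats"
    "[True, False, True, False, False, False, True, True, True, False] \<in> set pats"
    "[False, True, True, False, True, False, True, False, False, True] \<in> set pats"
    "[False, True, False, True, False, True, True, True, False, False] \<in> set pats"
    "[False, False, True, True, True, True, False, False, True, False] \<in> set pats"
    by (simp_all add: pats_def)
  obtain q1 where q1: "q1 \<in> E - A - {q0}" "p q1 = [True, True, False, False, False, True, False, False, True, True]"
    using pats_im [OF pats_mem(1)] by blast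
  obtain q2 where q2: "q2 \<in> E - A - {q0}" "p q2 = [True, False, True, False, False, False, True, True, True, False]"
    using pats_im [OF pats_mem(2)] by blast
  obtain q3 where q3: "q3 \<in> E - A - {q0}" "p q3 = [False, True, True, False, True, False, True, False, False, True]"
    using pats_im [OF pats_mem(3)] by blast
  obtain q4 where q4: "q4 \<in> E - A - {q0}" "p q4 = [False, True, False, True, False, True, True, True, False, False]"
    using pats_im [OF pats_mem(4)] by blast
  obtain q5 where q5: "q5 \<in> E - A - {q0}" "p q5 = [False, False, True, True, True, True, False, False, True, False]"
    using pats_im [OF pats_mem(5)] by blast
  note qs = q1(1) q2(1) q3(1) q4(1) q5(1) q1(2) q2(2) q3(2) q4(2) q5(2)
  have q_dist: "distinct [q0, q1, q2, q3, q4, q5]"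
    using qs by auto
  have q_set: "set [q0, q1, q2, q3, q4, q5] = E - A"
  proof (rule card_subset_eq)
    show "card (set [q0, q1, q2, q3, q4, q5]) = card (E - A)"
      unfolding distinct_card [OF q_dist] card_Q by simp
  qed (use finite_E q0 qs in auto)
  define es where "es = [a0, a1, a2, a3, a4, q0, q1, q2, q3, q4, q5]"
  have es_set: "set es = E"
    using q_set a(2) A(1) unfolding es_def by auto
  have es_dist: "distinct es"
  proof -
    have "distinct ([a0, a1, a2, a3, a4] @ [q0, q1, q2, q3, q4, q5])"
      using a q_dist q_set unfolding distinct_append by blast
    then show ?thesis
      by (simp add: es_def)
  qed
  have B_filter: "B j = set (filter (\<lambda>x. x \<in> B j) es)" if "j \<in> D" for j
    using block_sub [OF that] es_set by auto
  have q_mem: "q1 \<in> B (J a0 a1)"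
    "q1 \<in> B (J a0 a2)"
    "q1 \<notin> B (J a0 a3)"
    "q1 \<notin> B (J a0 a4)"
    "q1 \<notin> B (J a1 a2)"
    "q1 \<in> B (J a1 a3)"
    "q1 \<notin> B (J a1 a4)"
    "q1 \<notin> B (J a2 a3)"
    "q1 \<in> B (J a2 a4)"
    "q1 \<in> B (J a3 a4)"
    "q2 \<in> B (J a0 a1)"
    "q2 \<notin> B (J a0 a2)"
    "q2 \<in> B (J a0 a3)"
    "q2 \<notin> B (J a0 a4)"
    "q2 \<notin> B (J a1 a2)"
    "q2 \<notin> B (J a1 a3)"
    "q2 \<in> B (J a1 a4)"
    "q2 \<in> B (J a2 a3)"
    "q2 \<in> B (J a2 a4)"
    "q2 \<notin> B (J a3 a4)"
    "q3 \<notin> B (J a0 a1)"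
    "q3 \<in> B (J a0 a2)"
    "q3 \<in> B (J a0 a3)"
    "q3 \<notin> B (J a0 a4)"
    "q3 \<in> B (J a1 a2)"
    "q3 \<notin> B (J a1 a3)"
    "q3 \<in> B (J a1 a4)"
    "q3 \<notin> B (J a2 a3)"
    "q3 \<notin> B (J a2 a4)"
    "q3 \<in> B (J a3 a4)"
    "q4 \<notin> B (J a0 a1)"
    "q4 \<in> B (J a0 a2)"
    "q4 \<notin> B (J a0 a3)"
    "q4 \<in> B (J a0 a4)"
    "q4 \<notin> B (J a1 a2)"
    "q4 \<in> B (J a1 a3)"
    "q4 \<in> B (J a1 a4)"
    "q4 \<in> B (J a2 a3)"
    "q4 \<notin> B (J a2 a4)"
    "q4 \<notin> B (J a3 a4)"
    "q5 \<notin> B (J a0 a1)"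
    "q5 \<notin> B (J a0 a2)"
    "q5 \<in> B (J a0 a3)"
    "q5 \<in> B (J a0 a4)"
    "q5 \<in> B (J a1 a2)"
    "q5 \<in> B (J a1 a3)"
    "q5 \<notin> B (J a1 a4)"
    "q5 \<notin> B (J a2 a3)"
    "q5 \<in> B (J a2 a4)"
    "q5 \<notin> B (J a3 a4)"
    using qs(6-10) unfolding p_def js_def list.map list.inject by simp_all
  have "B ((b # js) ! i) = (!) es ` set (biplane_table ! i)" if "i < 11" for i
  proof -
    have B_b: "B b = {a0, a1, a2, a3, a4}"
      using a(2) unfolding A_def by simp
    have B_J: "B (J a0 a1) = {a0, a1, q0, q1, q2}"
      "B (J a0 a2) = {a0, a2, q1, q3, q4}"
      "B (J a0 a3) = {a0, a3, q2, q3, q5}"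
      "B (J a0 a4) = {a0, a4, q0, q4, q5}"
      "B (J a1 a2) = {a1, a2, q0, q3, q5}"
      "B (J a1 a3) = {a1, a3, q1, q4, q5}"
      "B (J a1 a4) = {a1, a4, q2, q3, q4}"
      "B (J a2 a3) = {a2, a3, q0, q2, q4}"
      "B (J a2 a4) = {a2, a4, q1, q2, q5}"
      "B (J a3 a4) = {a3, a4, q0, q1, q3}"
      by (subst B_filter; use J_D(1) in_A ne q0_edges q0_non q_mem in \<open>simp add: es_def J_mem\<close>)+
    have "i \<in> {0, 1, 2, 3, 4, 5, 6, 7, 8, 9, 10}"
      using that unfolding insert_iff empty_iff by presburger
    then show ?thesis
      unfolding es_def js_def biplane_table_def
      by (elim insertE emptyE) (simp_all only:, simp_all add: B_b B_J)
  qed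
  then have "distinct (b # js) \<and> set (b # js) = D \<and> length (b # js) = 11 \<and> distinct es \<and> set es = E
      \<and> length es = 11 \<and> (\<forall>i<11. B ((b # js) ! i) = (!) es ` set (biplane_table ! i))"
    using dist \<open>set (b # js) = D\<close> es_dist es_set by (simp add: js_def es_def)
  then show ?thesis
    by blast
qed

end

subsection \<open>The extended Golay code\<close>

definition golay_generator :: "nat \<Rightarrow> nat set" where
  "golay_generator i = ((\<lambda>j. (i + j) mod 23) ` {0,2,4,5,6,10,11}) \<union> {23}"

lemma golay24_eq: "golay24 = xor_sum ` Pow (golay_generator ` {..<12})"
  unfolding golay24_def span2_def golay_generator_def by auto

text \<open>The largest position is 11 + 11 = 22, so none of these shifts wraps around modulo
  23.\<close>

lemma golay_generator_eq:
  assumes "i < 12"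
  shows "golay_generator i = (+) i ` {0,2,4,5,6,10,11} \<union> {23}"
  using assms by (auto simp: golay_generator_def)

lemma golay_generator_subset: "i < 12 \<Longrightarrow> golay_generator i \<subseteq> {..<24}"
  by (auto simp: golay_generator_eq)

text \<open>The generator polynomial has constant term 1, so the shift by \<open>i\<close> starts at
  position \<open>i\<close>; the bound on \<open>k\<close> keeps the parity coordinate 23
  out.\<close>

lemma golay_generator_triangular:
  assumes "i < 12" "k < 12"
  shows "i \<in> golay_generator i" and "k \<in> golay_generator i \<Longrightarrow> i \<le> k"
  using assms by (auto simp: golay_generator_eq)

text \<open>Linear independence by triangularity: at the least index \<open>i\<close> where
  \<open>T\<close> and \<open>T'\<close> differ, coordinate \<open>i\<close> meets only generators
  of index at most \<open>i\<close>, so the two parities there differ by one.\<close>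

lemma inj_on_xor_sum_golay: "inj_on xor_sum (Pow (golay_generator ` {..<12}))"
proof (rule inj_onI, rule ccontr)
  fix T T'
  assume T: "T \<in> Pow (golay_generator ` {..<12})" "T' \<in> Pow (golay_generator ` {..<12})"
    and eq: "xor_sum T = xor_sum T'" and "T \<noteq> T'"
  define P where "P i \<longleftrightarrow> i < 12 \<and> (golay_generator i \<in> T \<longleftrightarrow> golay_generator i \<notin> T')" for i
  have "\<exists>i. P i"
    using T \<open>T \<noteq> T'\<close> unfolding P_def by blast
  then obtain i where i: "P i" and least: "\<And>k. k < i \<Longrightarrow> \<not> P k"
    using exists_least_iff [of P] by blast
  let ?g = "golay_generator i"
  let ?R = "{s \<in> T. i \<in> s} - {?g}"
  have "finite T" "finite T'"
    using T by (auto intro: finite_subset)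
  have agree: "golay_generator k \<in> T \<longleftrightarrow> golay_generator k \<in> T'"
    if "k < 12" "i \<in> golay_generator k" "golay_generator k \<noteq> ?g" for k
  proof -
    have "k < i"
      using golay_generator_triangular(2) [of k i] that i by (auto simp: P_def le_less)
    then show ?thesis
      using least [of k] that by (auto simp: P_def)
  qed
  have R: "?R = {s \<in> T'. i \<in> s} - {?g}"
  proof (intro equalityI subsetI)
    fix s assume s: "s \<in> ?R"
    then obtain k where "k < 12" "s = golay_generator k"
      using T s by blast
    then show "s \<in> {s \<in> T'. i \<in> s} - {?g}"
      using s agree by auto
  next
    fix s assume s: "s \<in> {s \<in> T'. i \<in> s} - {?g}"
    then obtain k where "k < 12" "s = golay_generator k"
      using T s by blast
    then show "s \<in> ?R"
      using s agree by auto
  qed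
  have g: "i \<in> ?g"
    using golay_generator_triangular(1) i by (auto simp: P_def)
  have "card {s \<in> U. i \<in> s} = (if ?g \<in> U then Suc (card ({s \<in> U. i \<in> s} - {?g})) else card ({s \<in> U. i \<in> s} - {?g}))"
    if "finite U" for U
  proof (cases "?g \<in> U")
    case True
    then have "?g \<in> {s \<in> U. i \<in> s}"
      using g by simp
    then have "Suc (card ({s \<in> U. i \<in> s} - {?g})) = card {s \<in> U. i \<in> s}"
      using that by (intro card_Suc_Diff1) auto
    then show ?thesis
      using True by simp
  qed simp
  note split = this
  define m where "m = card ?R"
  have "card {s \<in> T. i \<in> s} = (if ?g \<in> T then Suc m else m)"
    unfolding m_def by (rule split [OF \<open>finite T\<close>])
  moreover have "card {s \<in> T'. i \<in> s} = (if ?g \<in> T' then Suc m else m)"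
    unfolding m_def R by (rule split [OF \<open>finite T'\<close>])
  moreover have "?g \<in> T \<longleftrightarrow> ?g \<notin> T'"
    using i by (simp add: P_def)
  moreover have "odd (card {s \<in> T. i \<in> s}) = odd (card {s \<in> T'. i \<in> s})"
  proof -
    have "i \<in> xor_sum T \<longleftrightarrow> i \<in> xor_sum T'"
      using eq by simp
    then show ?thesis
      by (simp only: xor_sum_def mem_Collect_eq)
  qed
  ultimately show False
    by (cases "?g \<in> T") simp_all
qed

lemma card_golay24: "card golay24 = 4096"
proof -
  have "inj_on golay_generator {..<12}"
    by (rule inj_onI) (metis golay_generator_triangular lessThan_iff le_antisym)
  then have "card (golay_generator ` {..<12}) = 12"
    by (simp add: card_image)
  then have "card (Pow (golay_generator ` {..<12})) = 2 ^ 12"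
    by (simp add: card_Pow)
  then show ?thesis
    unfolding golay24_eq card_image [OF inj_on_xor_sum_golay] by simp
qed

section \<open>Recognising \<open>golay24\<close> from twelve words\<close>

lemma xor_sum_empty: "xor_sum {} = {}"
  by (simp add: xor_sum_def)

lemma xor_sum_insert:
  assumes "finite T" "s \<notin> T"
  shows "xor_sum (insert s T) = vadd s (xor_sum T)"
proof -
  have "odd (card {r \<in> insert s T. x \<in> r}) \<longleftrightarrow> (x \<in> s \<longleftrightarrow> even (card {r \<in> T. x \<in> r}))" for x
  proof -
    have "{r \<in> insert s T. x \<in> r} = (if x \<in> s then insert s {r \<in> T. x \<in> r} else {r \<in> T. x \<in> r})"
      by auto
    then show ?thesis
      using assms by simp
  qed
  then show ?thesis
    by (intro set_eqI) (simp add: xor_sum_def mem_vadd)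
qed

lemma xor_sum_mem:
  assumes "binary_linear_code n C" "finite T" "T \<subseteq> C"
  shows "xor_sum T \<in> C"
  using assms(2,3)
proof (induction T rule: finite_induct)
  case empty
  then show ?case
    using assms(1) by (simp add: xor_sum_empty binary_linear_code_def)
next
  case (insert s T)
  then show ?case
    using assms(1) by (simp add: xor_sum_insert binary_linear_code_def)
qed

text \<open>Labels of the 24 coordinates: 0 is the distinguished point of the dodecad, \<open>1 + j\<close> stands for
  block \<open>j\<close> of the biplane, 12 is the distinguished point outside the dodecad, and \<open>13 + x\<close> is
  point \<open>x\<close> of the biplane.\<close>

definition table_word :: "nat \<Rightarrow> nat set" where
  "table_word j = (if j = 11 then {12..<24} else {0, 1 + j, 12} \<union> (\<lambda>x. 13 + x) ` set (biplane_table ! j))"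

text \<open>The label of each coordinate of \<open>golay24\<close>, for its dodecad \<open>{0,1,2,3,4,5,6,7,11,14,15,19}\<close>
  with the distinguished points 0 and 23; the combinations express the generators in terms of the
  table words and come from a computer search.\<close>

definition golay_labels :: "nat list" where
  "golay_labels = [0, 1, 10, 11, 4, 5, 6, 3, 13, 18, 23, 7, 20, 19, 8, 2, 14, 17, 22, 9, 16, 15, 21, 12]"

definition golay_combinations :: "nat list list" where
  "golay_combinations =
   [[3, 4, 5, 6, 9], [0, 2, 4, 5, 6, 10, 11], [2, 3, 5, 9, 11], [2, 4, 7, 10, 11],
    [1, 3, 5, 7, 11], [1, 2, 4, 6, 11], [5, 6, 11], [2, 6, 11], [7, 8, 11],
    [1, 6, 7, 8, 11], [1, 7, 11], [1, 6, 11]]"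

lemma golay_generators_from_table:
  "\<forall>i\<in>set [0..<12]. (!) golay_labels ` golay_generator i
      = foldr vadd (map table_word (golay_combinations ! i)) {}"
  by code_simp

lemma golay_combinations_bound: "\<forall>i\<in>set [0..<12]. \<forall>j\<in>set (golay_combinations ! i). j < 12"
  by code_simp

lemma golay_labels_bij: "bij_betw ((!) golay_labels) {..<24} {..<24}"
proof (rule bij_betw_nth)
  show "distinct golay_labels" "{..<24} = {..<length golay_labels}"
    by (simp_all add: golay_labels_def)
  have "set golay_labels = set [0..<24]"
    by code_simp
  then show "{..<24} = set golay_labels"
    by (simp only: set_upt lessThan_atLeast0)
qed

lemma image_vadd:
  assumes "inj_on f U" "a \<subseteq> U" "b \<subseteq> U"
  shows "f ` vadd a b = vadd (f ` a) (f ` b)"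
proof -
  have "f ` (a - b) = f ` a - f ` b" "f ` (b - a) = f ` b - f ` a"
    using assms by (auto intro!: inj_on_image_set_diff [OF assms(1)])
  then show ?thesis
    by (simp add: vadd_def image_Un)
qed

text \<open>This lets sums of words be formed in relabelled coordinates.\<close>

lemma binary_linear_code_preimage:
  assumes "binary_linear_code n C" "inj_on f {..<n}"
  shows "binary_linear_code n {S. S \<subseteq> {..<n} \<and> f ` S \<in> C}"
  unfolding binary_linear_code_def
proof (intro conjI ballI)
  show "vadd a b \<in> {S. S \<subseteq> {..<n} \<and> f ` S \<in> C}"
    if "a \<in> {S. S \<subseteq> {..<n} \<and> f ` S \<in> C}" "b \<in> {S. S \<subseteq> {..<n} \<and> f ` S \<in> C}" for a b
  proof -
    have "f ` vadd a b = vadd (f ` a) (f ` b)"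
      using that assms(2) by (intro image_vadd) auto
    moreover have "vadd (f ` a) (f ` b) \<in> C"
      using that assms(1) by (simp add: binary_linear_code_def)
    moreover have "vadd a b \<subseteq> {..<n}"
      using that by (auto simp: vadd_def)
    ultimately show ?thesis
      by simp
  qed
qed (use assms(1) in \<open>auto simp: binary_linear_code_def\<close>)

text \<open>Every generator of \<open>golay24\<close> is, after relabelling, a sum of table words,
  so a copy of \<open>golay24\<close> lies in \<open>C\<close>; both have 4096 words, which forces
  equality.\<close>

lemma code_equiv_golay24_if_table_words:
  assumes lin: "binary_linear_code 24 C" and card: "card C = 4096"
    and pts: "bij_betw f {..<24} {..<24}" and words: "\<And>j. j < 12 \<Longrightarrow> f ` table_word j \<in> C"
  shows "code_equiv 24 C golay24"
proof -
  define C' where "C' = {S. S \<subseteq> {..<24} \<and> f ` S \<in> C}"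
  have inj_f: "inj_on f {..<24}"
    using pts by (rule bij_betw_imp_inj_on)
  have lin': "binary_linear_code 24 C'"
    unfolding C'_def using lin inj_f by (rule binary_linear_code_preimage)
  have "table_word j \<subseteq> {..<24}" if "j < 12" for j
  proof -
    have "\<forall>j\<in>set [0..<12]. table_word j \<subseteq> set [0..<24]"
      by code_simp
    then show ?thesis
      using that by (auto simp: atLeast0LessThan)
  qed
  then have words': "table_word j \<in> C'" if "j < 12" for j
    using that words by (simp add: C'_def)
  have comb: "foldr vadd (map table_word js) {} \<in> C'" if "\<forall>j\<in>set js. j < 12" for js
    using that lin' words' by (induction js) (auto simp: binary_linear_code_def)
  let ?l = "(!) golay_labels"
  \<comment> \<open>A coordinate of \<open>golay24\<close> is sent to its label, and the label to a
    coordinate of \<open>C\<close>.\<close>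
  define \<sigma> where "\<sigma> = f \<circ> ?l"
  have \<sigma>_bij: "bij_betw \<sigma> {..<24} {..<24}"
    unfolding \<sigma>_def using golay_labels_bij pts by (rule bij_betw_trans)
  have inj_\<sigma>: "inj_on \<sigma> {..<24}"
    using \<sigma>_bij by (rule bij_betw_imp_inj_on)
  define C'' where "C'' = {S. S \<subseteq> {..<24} \<and> \<sigma> ` S \<in> C}"
  have lin'': "binary_linear_code 24 C''"
    unfolding C''_def using lin inj_\<sigma> by (rule binary_linear_code_preimage)
  have gen: "golay_generator i \<in> C''" if "i < 12" for i
  proof -
    have "?l ` golay_generator i \<in> C'"
      using golay_generators_from_table golay_combinations_bound comb that by (simp add: atLeast0LessThan)
    then show ?thesis
      using golay_generator_subset [OF that] by (simp add: C''_def C'_def \<sigma>_def image_comp)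
  qed
  have "golay24 \<subseteq> C''"
  proof
    fix c assume "c \<in> golay24"
    then obtain T where "c = xor_sum T" "T \<subseteq> golay_generator ` {..<12}"
      unfolding golay24_eq by auto
    then show "c \<in> C''"
      using gen by (auto intro!: xor_sum_mem [OF lin''] intro: finite_subset)
  qed
  then have sub: "golay24 \<subseteq> Pow {..<24}" and im: "(`) \<sigma> ` golay24 \<subseteq> C"
    by (auto simp: C''_def)
  have "card ((`) \<sigma> ` golay24) = card C"
    using card_image [OF inj_on_subset [OF inj_on_image_Pow [OF inj_\<sigma>] sub]] card_golay24 card by simp
  moreover have "finite C"
    using card card_gt_0_iff [of C] by simp
  ultimately have "(`) \<sigma> ` golay24 = C"
    using im by (intro card_subset_eq) auto
  then show ?thesis
    unfolding code_equiv_def using \<sigma>_bij by blast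
qed

text \<open>Toggling a fixed point \<open>d\<close> is an involution that reverses parity.\<close>

lemma card_even_subsets:
  assumes "finite D" "D \<noteq> {}"
  shows "2 * card {X. X \<subseteq> D \<and> even (card X)} = 2 ^ card D"
proof -
  obtain d where d: "d \<in> D"
    using assms by blast
  let ?ev = "{X. X \<subseteq> D \<and> even (card X)}" and ?od = "{X. X \<subseteq> D \<and> odd (card X)}"
  define t where "t X = (if d \<in> X then X - {d} else insert d X)" for X
  have parity: "even (card (t X)) \<longleftrightarrow> odd (card X)" if "X \<subseteq> D" for X
  proof -
    have fin: "finite X"
      using that assms finite_subset by blast
    show ?thesis
    proof (cases "d \<in> X")
      case True
      have "Suc (card (X - {d})) = card X"
        using fin True by (rule card_Suc_Diff1)
      then have "even (card (X - {d})) \<longleftrightarrow> odd (card X)"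
        by (metis even_Suc)
      then show ?thesis
        by (simp only: t_def True if_True)
    qed (use fin in \<open>simp add: t_def\<close>)
  qed
  have "t X \<subseteq> D" if "X \<subseteq> D" for X
    using that d by (auto simp: t_def)
  moreover have "t (t X) = X" for X
    by (auto simp: t_def)
  ultimately have "bij_betw t ?ev ?od"
    using parity by (intro bij_betw_byWitness [where f' = t]) auto
  then have "card ?ev = card ?od"
    by (rule bij_betw_same_card)
  moreover have "card (?ev \<union> ?od) = card ?ev + card ?od"
    using assms by (intro card_Un_disjoint) auto
  moreover have "?ev \<union> ?od = Pow D"
    by auto
  ultimately show ?thesis
    using assms by (simp add: card_Pow)
qed

section \<open>Dodecads and octads in a code with the Golay weights\<close>

locale golay_weight_code =
  fixes C :: "nat set set"
  assumes linear: "binary_linear_code 24 C" and ones: "{..<24} \<in> C" and size: "card C = 4096"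
    and weight: "c \<in> C \<Longrightarrow> card c \<in> {0, 8, 12, 16, 24}"
begin

lemma subset: "c \<in> C \<Longrightarrow> c \<subseteq> {..<24}"
  and vadd_mem: "a \<in> C \<Longrightarrow> b \<in> C \<Longrightarrow> vadd a b \<in> C"
  using linear by (auto simp: binary_linear_code_def)

lemma finite_word: "c \<in> C \<Longrightarrow> finite c"
  using subset finite_subset by blast

text \<open>All weights are divisible by 4, so the weight of the sum shows that twice the
  intersection is too.\<close>

lemma even_card_Int:
  assumes "a \<in> C" "b \<in> C"
  shows "even (card (a \<inter> b))"
proof -
  have dvd: "4 dvd card c" if "c \<in> C" for c
    using weight [OF that] by auto
  have "card (vadd a b) + 2 * card (a \<inter> b) = card a + card b"
    using assms finite_word by (intro card_vadd) auto
  then have "4 dvd 2 * card (a \<inter> b)"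
    using dvd [OF assms(1)] dvd [OF assms(2)] dvd [OF vadd_mem [OF assms]]
    by (metis dvd_add dvd_add_right_iff)
  then show ?thesis
    by presburger
qed

lemma compl_mem:
  assumes "c \<in> C"
  shows "{..<24} - c \<in> C"
proof -
  have "vadd {..<24} c = {..<24} - c"
    using subset [OF assms] by (auto simp: vadd_def)
  then show ?thesis
    using vadd_mem [OF ones assms] by simp
qed

context
  fixes D assumes D: "D \<in> C" "card D = 12"
begin

lemma card_compl_dodecad: "card ({..<24} - D) = 12"
  using D subset finite_word by (simp add: card_Diff_subset)

text \<open>A word of weight 8 inside the complementary dodecad would leave a word of weight 4
  there.\<close>

lemma disjoint_dodecad:
  assumes "c \<in> C" "c \<inter> D = {}"
  shows "c = {} \<or> c = {..<24} - D"
proof -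
  let ?E = "{..<24} - D"
  have sub: "c \<subseteq> ?E"
    using assms subset by blast
  have "card c \<le> 12"
    using card_mono [OF _ sub] card_compl_dodecad by simp
  then consider "card c = 0" | "card c = 8" | "card c = 12"
    using weight [OF assms(1)] by auto
  then show ?thesis
  proof cases
    case 1
    then show ?thesis
      using finite_word [OF assms(1)] by simp
  next
    case 2
    have "card (vadd ?E c) + 2 * card (?E \<inter> c) = card ?E + card c"
      using assms finite_word by (intro card_vadd) auto
    moreover have "?E \<inter> c = c"
      using sub by blast
    ultimately have "card (vadd ?E c) = 4"
      using 2 card_compl_dodecad by simp
    then show ?thesis
      using weight [OF vadd_mem [OF compl_mem [OF D(1)] assms(1)]] by simp
  next
    case 3
    then show ?thesis
      using card_subset_eq [OF _ sub] card_compl_dodecad by simp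
  qed
qed

text \<open>Restriction to \<open>D\<close> identifies at most two words, so it has at least
  \<open>4096 / 2 = 2 ^ 11\<close> images; all are even subsets of \<open>D\<close>, of which there
  are just as many.\<close>

lemma even_subset_of_dodecad:
  assumes X: "X \<subseteq> D" "even (card X)"
  obtains c where "c \<in> C" "c \<inter> D = X"
proof -
  let ?E = "{..<24} - D" and ?f = "\<lambda>c. c \<inter> D" and ?ev = "{X. X \<subseteq> D \<and> even (card X)}"
  have finC: "finite C"
    using size card_gt_0_iff [of C] by simp
  have fibre: "card {c \<in> C. c \<inter> D = Y} \<le> 2" if "Y \<in> ?f ` C" for Y
  proof -
    from that obtain c0 where c0: "c0 \<in> C" "c0 \<inter> D = Y"
      by blast
    have "{c \<in> C. c \<inter> D = Y} \<subseteq> {c0, vadd c0 ?E}"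
    proof
      fix c assume c: "c \<in> {c \<in> C. c \<inter> D = Y}"
      then have "vadd c0 c \<inter> D = {}"
        using c0 by (auto simp: vadd_def)
      then have "vadd c0 c = {} \<or> vadd c0 c = ?E"
        using c c0 vadd_mem by (intro disjoint_dodecad) auto
      moreover have "vadd c0 (vadd c0 c) = c" "vadd c0 {} = c0"
        by (auto simp: vadd_def)
      ultimately have "c = c0 \<or> c = vadd c0 ?E"
        by metis
      then show "c \<in> {c0, vadd c0 ?E}"
        by simp
    qed
    then have "card {c \<in> C. c \<inter> D = Y} \<le> card {c0, vadd c0 ?E}"
      by (intro card_mono) auto
    also have "\<dots> \<le> 2"
      by (simp add: card_insert_if)
    finally show ?thesis .
  qed
  have sub: "?f ` C \<subseteq> ?ev"
    using even_card_Int D(1) by auto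
  have "C = (\<Union>Y\<in>?f ` C. {c \<in> C. c \<inter> D = Y})"
    by auto
  then have "card C \<le> (\<Sum>Y\<in>?f ` C. card {c \<in> C. c \<inter> D = Y})"
    using card_UN_le [of "?f ` C" "\<lambda>Y. {c \<in> C. c \<inter> D = Y}"] finC by simp
  also have "\<dots> \<le> (\<Sum>Y\<in>?f ` C. 2)"
    using fibre by (rule sum_mono)
  finally have "2048 \<le> card (?f ` C)"
    using size by simp
  moreover have "D \<noteq> {}"
    using D by auto
  ultimately have "card ?ev \<le> card (?f ` C)"
    using card_even_subsets [OF finite_word [OF D(1)]] D(2) by simp
  moreover have "finite ?ev"
    using finite_word [OF D(1)] by simp
  ultimately have "?f ` C = ?ev"
    using sub card_mono [OF _ sub] by (intro card_subset_eq) auto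
  then have "X \<in> ?f ` C"
    using X by simp
  then show ?thesis
    using that by blast
qed

text \<open>With \<open>m\<close> points outside \<open>D\<close>, the weights of \<open>c\<close>
  and of its sum with the complementary dodecad are \<open>2 + m\<close> and \<open>14 - m\<close>;
  both are admissible only for \<open>m = 6\<close>.\<close>

lemma card_outside_dodecad:
  assumes c: "c \<in> C" "c \<inter> D = {i, j}" "i \<noteq> j"
  shows "card (c - D) = 6"
proof -
  let ?E = "{..<24} - D"
  have fin: "finite c"
    using c finite_word by blast
  have "card c = card (c \<inter> D) + card (c - D)"
    using fin by (subst card_Un_disjoint [symmetric]) (auto intro: arg_cong [where f = card])
  then have c2: "card c = 2 + card (c - D)"
    using c by simp
  have "?E \<inter> c = c - D"
    using subset [OF c(1)] by blast
  then have "card (vadd ?E c) + 2 * card (c - D) = 12 + card c"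
    using card_vadd [of ?E c] fin card_compl_dodecad by simp
  then have "card (vadd ?E c) + card (c - D) = 14"
    using c2 by simp
  moreover have "card (c - D) \<le> card ?E"
    using subset [OF c(1)] by (intro card_mono) auto
  then have "card (c - D) \<le> 12"
    using card_compl_dodecad by simp
  ultimately show ?thesis
    using c2 weight [OF c(1)] weight [OF vadd_mem [OF compl_mem [OF D(1)] c(1)]] by auto
qed

text \<open>The weight 8 is not demanded: it follows from \<open>card_outside_dodecad\<close> when
  \<open>i\<close> and \<open>j\<close> are distinct.\<close>

definition pair_octad :: "nat \<Rightarrow> nat \<Rightarrow> nat \<Rightarrow> nat set" where
  "pair_octad z i j = (SOME c. c \<in> C \<and> c \<inter> D = {i, j} \<and> z \<in> c)"

context
  fixes z i assumes z: "z < 24" "z \<notin> D" and i: "i \<in> D"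
begin

lemma pair_octad:
  assumes j: "j \<in> D" "j \<noteq> i"
  shows "pair_octad z i j \<in> C" "pair_octad z i j \<inter> D = {i, j}" "z \<in> pair_octad z i j"
    and "card (pair_octad z i j - D - {z}) = 5"
proof -
  let ?E = "{..<24} - D"
  have "{i, j} \<subseteq> D" "even (card {i, j})"
    using i j by auto
  then obtain c where c: "c \<in> C" "c \<inter> D = {i, j}"
    by (rule even_subset_of_dodecad)
  have "\<exists>c. c \<in> C \<and> c \<inter> D = {i, j} \<and> z \<in> c"
  proof (cases "z \<in> c")
    \<comment> \<open>Adding the complementary dodecad keeps the trace on \<open>D\<close> and
      brings \<open>z\<close> into the word.\<close>
    case False
    have "vadd ?E c \<inter> D = {i, j}" "z \<in> vadd ?E c"
      using c(2) False z by (auto simp: vadd_def)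
    then show ?thesis
      using vadd_mem [OF compl_mem [OF D(1)] c(1)] by blast
  qed (use c in blast)
  then have *: "pair_octad z i j \<in> C \<and> pair_octad z i j \<inter> D = {i, j} \<and> z \<in> pair_octad z i j"
    unfolding pair_octad_def by (rule someI_ex)
  then show "pair_octad z i j \<in> C" "pair_octad z i j \<inter> D = {i, j}" "z \<in> pair_octad z i j"
    by auto
  have "card (pair_octad z i j - D) = 6"
    using * j by (intro card_outside_dodecad) auto
  then show "card (pair_octad z i j - D - {z}) = 5"
    using * z by (simp add: card_Diff_singleton)
qed

text \<open>The sum of the two octads meets \<open>D\<close> in \<open>{j, j'}\<close>, so it has 6
  points outside; the overlap is (5 + 5 - 6) / 2.\<close>

lemma pair_octad_Int:
  assumes "j \<in> D" "j \<noteq> i" "j' \<in> D" "j' \<noteq> i" "j \<noteq> j'"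
  shows "card ((pair_octad z i j - D - {z}) \<inter> (pair_octad z i j' - D - {z})) = 2"
proof -
  let ?w = "pair_octad z i j" and ?w' = "pair_octad z i j'"
  note w = pair_octad [OF assms(1,2)] and w' = pair_octad [OF assms(3,4)]
  have fin: "finite ?w" "finite ?w'"
    using w w' finite_word by auto
  have "vadd ?w ?w' \<inter> D = vadd (?w \<inter> D) (?w' \<inter> D)"
    by (auto simp: vadd_def)
  also have "\<dots> = {j, j'}"
    using w(2) w'(2) assms by (auto simp: vadd_def)
  finally have "card (vadd ?w ?w' - D) = 6"
    using w(1) w'(1) vadd_mem assms(5) by (intro card_outside_dodecad [of _ j j']) auto
  moreover have "vadd ?w ?w' - D = vadd (?w - D - {z}) (?w' - D - {z})"
    using w(3) w'(3) by (auto simp: vadd_def)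
  ultimately have "card (vadd (?w - D - {z}) (?w' - D - {z})) = 6"
    by simp
  then show ?thesis
    using card_vadd [of "?w - D - {z}" "?w' - D - {z}"] fin w(4) w'(4) by simp
qed

end

end

text \<open>The octads \<open>w j\<close> supply the blocks; the octads \<open>u x\<close> arise
  from the same construction with \<open>D\<close>, \<open>i\<close> and \<open>E\<close>,
  \<open>z\<close> exchanged and supply the dual structure.\<close>

lemma code_equiv_golay24:
  assumes D: "D \<in> C" "card D = 12"
  shows "code_equiv 24 C golay24"
proof -
  define E where "E = {..<24} - D"
  have E: "E \<in> C" "card E = 12"
    unfolding E_def using compl_mem [OF D(1)] card_compl_dodecad [OF D] by auto
  have D_E: "D = {..<24} - E" "D \<inter> E = {}" "D \<union> E = {..<24}"
    using subset [OF D(1)] by (auto simp: E_def)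
  have "D \<noteq> {}" "E \<noteq> {}"
    using D E by auto
  then obtain i z where i: "i \<in> D" and z: "z \<in> E"
    by blast
  have iz: "i < 24" "z < 24" "z \<notin> D" "i \<notin> E" "i \<noteq> z"
    using i z D_E by auto
  define w where "w = pair_octad D z i"
  define u where "u = pair_octad E i z"
  note w = pair_octad [OF D iz(2,3) i, folded w_def]
  note u = pair_octad [OF E iz(1,4) z, folded u_def]
  define B where "B j = w j - D - {z}" for j
  have B_E: "B j \<subseteq> E - {z}" if "j \<in> D - {i}" for j
    using subset [OF w(1) [of j]] that unfolding B_def E_def by auto
  \<comment> \<open>The octads \<open>w j\<close> and \<open>u x\<close> share \<open>i\<close> and
    \<open>z\<close>, possibly \<open>j\<close> and possibly \<open>x\<close>; an even intersection
    forces both or neither.\<close>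
  have dual: "x \<in> B j \<longleftrightarrow> j \<in> u x" if j: "j \<in> D - {i}" and x: "x \<in> E - {z}" for j x
  proof -
    have wj: "w j \<inter> D = {i, j}" "z \<in> w j" "w j \<in> C" and ux: "u x \<inter> E = {z, x}" "i \<in> u x" "u x \<in> C"
      using w [of j] u [of x] j x by auto
    have "w j \<inter> u x = {i, z} \<union> ((if j \<in> u x then {j} else {}) \<union> (if x \<in> w j then {x} else {}))"
    proof -
      have "w j \<inter> u x = (w j \<inter> D) \<inter> u x \<union> w j \<inter> (u x \<inter> E)"
        using subset [OF wj(3)] D_E(3) by blast
      also have "\<dots> = {i, j} \<inter> u x \<union> w j \<inter> {z, x}"
        by (simp only: wj ux)
      finally show ?thesis
        using wj(2) ux(2) by auto
    qed
    moreover have "j \<noteq> x" "i \<noteq> x" "z \<noteq> j"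
      using j x i z D_E(2) by auto
    ultimately have "card (w j \<inter> u x) = 2 + (of_bool (j \<in> u x) + of_bool (x \<in> w j))"
      using j x iz(5) by auto
    then have "x \<in> w j \<longleftrightarrow> j \<in> u x"
      using even_card_Int [OF wj(3) ux(3)] by (cases "j \<in> u x"; cases "x \<in> w j") simp_all
    moreover have "x \<notin> D"
      using x D_E by blast
    ultimately show ?thesis
      using x by (auto simp: B_def)
  qed
  \<comment> \<open>The blocks through \<open>x\<close> form a block of the exchanged construction,
    so the point conditions of a biplane become its block conditions.\<close>
  have points: "{j \<in> D - {i}. x \<in> B j} = u x - E - {i}" if x: "x \<in> E - {z}" for x
  proof -
    have "u x \<subseteq> D \<union> E"
      using subset [OF u(1) [of x]] x D_E(3) by auto
    then show ?thesis
      using dual [OF _ x] D_E(2) by blast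
  qed
  interpret biplane_11 "D - {i}" "E - {z}" B
  proof
    show "card (D - {i}) = 11" "card (E - {z}) = 11"
      using D E i z by (simp_all add: card_Diff_singleton)
    show "B j \<subseteq> E - {z}" if "j \<in> D - {i}" for j
      using B_E [OF that] .
    show "card (B j) = 5" if "j \<in> D - {i}" for j
      using w(4) [of j] that by (simp add: B_def)
    show "card (B j \<inter> B j') = 2" if "j \<in> D - {i}" "j' \<in> D - {i}" "j \<noteq> j'" for j j'
      unfolding B_def w_def using that by (intro pair_octad_Int [OF D iz(2,3) i]) auto
    show "card {j \<in> D - {i}. x \<in> B j} = 5" if "x \<in> E - {z}" for x
      unfolding points [OF that] using u(4) [of x] that by simp
    show "card {j \<in> D - {i}. x \<in> B j \<and> y \<in> B j} = 2"
      if "x \<in> E - {z}" "y \<in> E - {z}" "x \<noteq> y" for x y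
    proof -
      have "{j \<in> D - {i}. x \<in> B j \<and> y \<in> B j} = {j \<in> D - {i}. x \<in> B j} \<inter> {j \<in> D - {i}. y \<in> B j}"
        by auto
      also have "\<dots> = (u x - E - {i}) \<inter> (u y - E - {i})"
        by (simp only: points [OF that(1)] points [OF that(2)])
      finally show ?thesis
        unfolding u_def using that by (simp add: pair_octad_Int [OF E iz(1,4) z])
    qed
  qed
  obtain ds es where ds: "distinct ds" "set ds = D - {i}" "length ds = 11"
    and es: "distinct es" "set es = E - {z}" "length es = 11"
    and table: "\<And>j. j < 11 \<Longrightarrow> B (ds ! j) = (!) es ` set (biplane_table ! j)"
    using biplane_enumeration by blast
  \<comment> \<open>The position in this list is the label used by
    \<open>table_word\<close>.\<close>
  define pts where "pts = i # ds @ z # es"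
  have pts_bij: "bij_betw ((!) pts) {..<24} {..<24}"
  proof (rule bij_betw_nth)
    show "distinct pts"
      using ds es i z D_E(2) unfolding pts_def by auto
    show "{..<24} = {..<length pts}"
      using ds es by (simp add: pts_def)
    show "{..<24} = set pts"
      using ds es i z D_E(3) unfolding pts_def by auto
  qed
  have pts_nth: "pts ! 0 = i" "pts ! 12 = z" "\<And>j. j < 11 \<Longrightarrow> pts ! (1 + j) = ds ! j"
    "\<And>x. pts ! (13 + x) = es ! x"
    using ds es by (auto simp: pts_def nth_append nth_Cons')
  have words: "(!) pts ` table_word j \<in> C" if "j < 12" for j
  proof (cases "j = 11")
    case True
    \<comment> \<open>Word 11 is the dodecad \<open>E\<close>; the other eleven table words are the
      octads \<open>w j\<close>.\<close>
    have "{12..<24} = insert 12 ((+) 13 ` {..<11::nat})"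
      unfolding lessThan_atLeast0 image_add_atLeastLessThan by auto
    then have "(!) pts ` {12..<24} = insert z ((!) es ` {..<11})"
      by (simp add: image_image pts_nth)
    also have "(!) es ` {..<11} = set es"
      using es(3) by (auto simp: set_conv_nth)
    finally have "(!) pts ` table_word j = E"
      using True es z by (auto simp: table_word_def)
    then show ?thesis
      using E by simp
  next
    case False
    then have j: "j < 11"
      using that by simp
    then have d: "ds ! j \<in> D" "ds ! j \<noteq> i"
      using ds nth_mem [of j ds] by auto
    have "(!) pts ` table_word j = {i, ds ! j, z} \<union> B (ds ! j)"
      using j False pts_nth table [OF j] by (simp add: table_word_def image_Un image_image)
    also have "\<dots> = w (ds ! j)"
      using w(2,3) [OF d] by (auto simp: B_def)
    finally show ?thesis
      using w(1) [OF d] by simp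
  qed
  show ?thesis
    using linear size pts_bij words by (rule code_equiv_golay24_if_table_words)
qed

end

theorem theorem1p4:
  fixes n k d dperp t :: nat and C :: "nat set set"
  assumes lin: "binary_linear_code n C"
    and dimk: "code_dim C k"
    and distd: "min_dist C d"
    and ones: "{..<n} \<in> C"
    and dualdist: "min_dist (dual_code n C) dperp"
    and tpos: "0 < t"
    and cond: "int dperp - int t = int (card {u. weight_class C u \<noteq> {} \<and> 0 < u \<and> u \<le> n - t})"
    and params: "dperp = 8" "t = 5"
  shows "n = 24 \<and> code_equiv 24 C golay24"
proof -
  interpret dual_distance_8_code n C
  proof
    show "8 \<le> card v" if "v \<in> dual_code n C" "v \<noteq> {}" for v
      using that dualdist params(1) by (auto simp: min_dist_def)
  qed (fact lin)
  obtain v where v: "v \<in> dual_code n C" "card v = 8"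
    using dualdist params(1) by (auto simp: min_dist_def)
  have three: "card weights = 3"
    using cond unfolding params by simp
  have size: "card C = 2 ^ k"
    using dimk by (simp add: code_dim_def)
  note pars = golay_parameters [OF ones size v three]
  interpret golay: golay_weight_code C
    using lin ones pars(1-3) by unfold_locales simp_all
  obtain D where "D \<in> C" "card D = 12"
    using pars(4) by blast
  then show ?thesis
    using pars(1) golay.code_equiv_golay24 by blast
qed

end
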